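(* Let $m\ge 1$ and $r\ge 2$ be integers, $B\subset\mathbb C^m$ the open Euclidean unit ball, $V$ a complex vector space of dimension $r$, and $F=B\times V\to B$ the trivial vector bundle. There are a positively curved metric $k$ on $O_{\mathbb P F}(1)$ and positive numbers $\rho<\rho'<1$ such that (a) for any $\mathrm{GL}(\mathbb C^r)$-equivariant map $\Psi:\mathsf K_{\mathbb C^r}\to\mathsf H_{\mathbb C^r}$ the metric $\Psi k$ on $F|\rho B$ fails to have semipositive curvature; (b) over $B\setminus\rho' B$, $k$ is of the form $k_h$, with $h$ a smooth metric on $F|(B\setminus\rho' B)$.
   Context: **Metrics and curvature.** A hermitian metric on a finite dimensional complex vector space $V$ is a function $\mathsf h:V\to\mathbb R$ of the form $\mathsf h(v)=\hat h(v,v)$, with $\hat h$ a positive definite hermitian form on $V$. A (hermitian) metric on a holomorphic vector bundle $E\to S$ is a function $h:E\to\mathbb R$ on the total space whose restriction to each fiber is a hermitian metric in this sense (no continuity is required a priori); it is smooth if $h$ is $C^\infty$. The metric $h$ is seminegatively curved if $h$ is plurisubharmonic on the total space $E$; it is negatively curved if $h$ is smooth and strongly plurisubharmonic ($i\partial\bar\partial h>0$) on $E$ away from the zero section. The metric $h$ is (semi)positively curved if the dual metric $h^*$ on the dual bundle $E^*$ is (semi)negatively curved. **The bundle $O_{\mathbb P E}(1)$.** For a holomorphic vector bundle $E\to S$, $\mathbb P E=\coprod_{s\in S}\mathbb P E_s$ is the set of hyperplanes (linear subspaces of codimension one) $P\subset E_s$ in the fibers of $E$, with its natural complex manifold structure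 and projection $\pi:\mathbb P E\to S$. Then $O_{\mathbb P E}(1)\to \mathbb P E$ is the holomorphic line bundle $(\pi^*E)/H$, where $H\subset\pi^*E$ is the tautological subbundle whose fiber over $P\in\mathbb P E_s$ is $P$; so its fiber over $P\in\mathbb P E_s$ is $E_s/P$. For a vector space $V$ (the case when $S$ is a point) this gives $O_{\mathbb P V}(1)\to\mathbb P V$. "Over $U$", for $U\subset S$, refers to the part of $O_{\mathbb P E}(1)$ lying above $U$ under $O_{\mathbb P E}(1)\to\mathbb P E\to S$, i.e. to $O_{\mathbb P(E|U)}(1)$. **The metric $k_h$.** If $h$ is a smooth hermitian metric on $E$, the metric $k_h$ on $O_{\mathbb P E}(1)$ is defined by $k_h(v+P)=\min_{v+P}h$ for $P\in\mathbb P E_s$, $v\in E_s$, where the element $v+P$ of the fiber $E_s/P$ is regarded as a translate of $P$ in $E_s$. **Equivariant maps.** $\mathsf H_V$ denotes the set of hermitian metrics on the vector space $V$, and $\mathsf K_V$ the set of positively curved metrics on $O_{\mathbb P V}(1)$. An isomorphism $\phi:V'\to V$ induces $\phi_{\mathsf H}:\mathsf H_V\to\mathsf H_{V'}$, $\phi_{\mathsf H}\mathsf h=\mathsf h\circ\phi$. It also induces $\phi_{\mathsf K}:\mathsf K_V\to\mathsf K_{V'}$: the isomorphisms $V'/P\to V/\phi(P)$, $P\in\mathbb P V'$, induced by $\phi$ together define an isomorphism $O_{\mathbb P V'}(1)\to O_{\mathbb P V}(1)$, and $\phi_{\mathsf K}\mathsf k$ is the pullback of $\mathsf k$ along it. A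 map $\Psi:\mathsf K_{\mathbb C^r}\to\mathsf H_{\mathbb C^r}$ is $\mathrm{GL}(\mathbb C^r)$-equivariant if $\phi_{\mathsf H}\circ\Psi=\Psi\circ\phi_{\mathsf K}$ for all $\phi\in\mathrm{GL}(\mathbb C^r)$. Such a $\Psi$ determines, for every $r$-dimensional complex vector space $V$, a map $\Psi_V=\psi_{\mathsf H}^{-1}\circ\Psi\circ\psi_{\mathsf K}:\mathsf K_V\to\mathsf H_V$, where $\psi:\mathbb C^r\to V$ is any isomorphism (the result does not depend on the choice of $\psi$). If $E\to S$ is a holomorphic vector bundle of rank $r$ and $k$ is a metric on $O_{\mathbb P E}(1)$ whose restriction to $O_{\mathbb P E_s}(1)$ is positively curved for every $s\in S$, the metric $\Psi k$ on $E$ is defined by $(\Psi k)|E_s=\Psi_{E_s}\big(k|O_{\mathbb P E_s}(1)\big)$, $s\in S$. For $\rho>0$, $\rho B=\{s\in\mathbb C^m:\|s\|<\rho\}$, with $\|\ \|$ the Euclidean norm. *)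

theory Defs
  imports "HOL-Analysis.Analysis"
begin

subsection \<open>Complex vector spaces\<close>

text \<open>A complex vector space is viewed together with its underlying real one.\<close>

class complex_vector = real_vector +
  fixes scaleC :: "complex \<Rightarrow> 'a \<Rightarrow> 'a"
  assumes scaleC_add_right: "scaleC c (x + y) = scaleC c x + scaleC c y"
    and scaleC_add_left: "scaleC (c + d) x = scaleC c x + scaleC d x"
    and scaleC_scaleC: "scaleC c (scaleC d x) = scaleC (c * d) x"
    and scaleR_scaleC: "scaleR r x = scaleC (complex_of_real r) x"

lemma scaleC_one: "scaleC 1 (x :: 'a::complex_vector) = x"
  using scaleR_scaleC[of 1 x] by simp

global_interpretation complex_vector:
  vector_space "scaleC :: complex \<Rightarrow> 'a \<Rightarrow> 'a::complex_vector"
  by unfold_locales (simp_all add: scaleC_add_right scaleC_add_left scaleC_scaleC scaleC_one)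

instantiation complex :: complex_vector
begin
definition "scaleC c (x::complex) = c * x"
instance by standard (auto simp: scaleC_complex_def algebra_simps scaleR_conv_of_real)
end

instantiation prod :: (complex_vector, complex_vector) complex_vector
begin
definition "scaleC c p = (scaleC c (fst p), scaleC c (snd p))"
instance
  by standard
    (auto simp: scaleC_prod_def scaleC_add_right scaleC_add_left scaleC_scaleC scaleR_scaleC
      intro!: prod_eqI)
end

instantiation vec :: (complex_vector, finite) complex_vector
begin
definition "scaleC c x = (\<chi> i. scaleC c (x $ i))"
instance
  by standard
    (auto simp: scaleC_vec_def vec_eq_iff scaleC_add_right scaleC_add_left scaleC_scaleC
      scaleR_scaleC)
end

abbreviation clinear :: "('a::complex_vector \<Rightarrow> 'b::complex_vector) \<Rightarrow> bool" where
  "clinear \<equiv> Vector_Spaces.linear scaleC scaleC"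

definition clinear_iso :: "('a::complex_vector \<Rightarrow> 'b::complex_vector) \<Rightarrow> bool" where
  "clinear_iso f \<longleftrightarrow> clinear f \<and> bij f"


subsection \<open>Smooth and plurisubharmonic functions\<close>

text \<open>For open U, this says that u is k times continuously differentiable on U.\<close>

primrec C_k_on :: "nat \<Rightarrow> 'a set \<Rightarrow> ('a::euclidean_space \<Rightarrow> real) \<Rightarrow> bool" where
  "C_k_on 0 U u \<longleftrightarrow> continuous_on U u"
| "C_k_on (Suc k) U u \<longleftrightarrow>
     u differentiable_on U \<and> (\<forall>v. C_k_on k U (\<lambda>x. frechet_derivative u (at x) v))"

text \<open>Smoothness on a set that need not be open: locally the function extends to a smooth
  function on an open set of the ambient space. (On an open set this is plain smoothness.)\<close>

definition smooth_on :: "'a set \<Rightarrow> ('a::euclidean_space \<Rightarrow> real) \<Rightarrow> bool" where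
  "smooth_on A u \<longleftrightarrow>
     (\<forall>x\<in>A. \<exists>U g. open U \<and> x \<in> U \<and> (\<forall>k. C_k_on k U g) \<and> (\<forall>y\<in>U \<inter> A. g y = u y))"

text \<open>The value at (w, w) of the hermitian form of the complex Hessian of u at x, i.e.
  $\sum_{j,k} u_{z_j \bar z_k}(x)\, w_j \bar w_k
   = \partial^2 u(x + \zeta w) / \partial\zeta\, \partial\bar\zeta$ at $\zeta = 0$.\<close>

definition levi_form ::
  "('a::{complex_vector,euclidean_space} \<Rightarrow> real) \<Rightarrow> 'a \<Rightarrow> 'a \<Rightarrow> real" where
  "levi_form u x w =
     (let D2 = (\<lambda>v. frechet_derivative (\<lambda>y. frechet_derivative u (at y) v) (at x) v)
      in (D2 w + D2 (scaleC \<i> w)) / 4)"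

definition strongly_psh_on ::
  "'a set \<Rightarrow> ('a::{complex_vector,euclidean_space} \<Rightarrow> real) \<Rightarrow> bool" where
  "strongly_psh_on U u \<longleftrightarrow> (\<forall>x\<in>U. \<forall>w. w \<noteq> 0 \<longrightarrow> levi_form u x w > 0)"

text \<open>Plurisubharmonicity, without any continuity assumption, of a function on an open set W:
  upper semicontinuity and the sub-mean value inequality on all closed discs contained in W.
  As u has no value $-\infty$, plurisubharmonicity forces its means over circles to be finite.\<close>

definition psh_on ::
  "'a set \<Rightarrow> ('a::{complex_vector,euclidean_space} \<Rightarrow> real) \<Rightarrow> bool" where
  "psh_on W u \<longleftrightarrow>
     (\<forall>c. openin (top_of_set W) {z \<in> W. u z < c}) \<and>
     (\<forall>p w. (\<forall>\<zeta>. cmod \<zeta> \<le> 1 \<longrightarrow> p + scaleC \<zeta> w \<in> W) \<longrightarrow>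
        (\<lambda>\<theta>. u (p + scaleC (cis \<theta>) w)) integrable_on {0..2 * pi} \<and>
        u p \<le> integral {0..2 * pi} (\<lambda>\<theta>. u (p + scaleC (cis \<theta>) w)) / (2 * pi))"


subsection \<open>Hermitian metrics and dual metrics\<close>

text \<open>Metrics are needed both on V and on quotients V/P. To treat them together, let q be a map
  from V such that range q carries the vector space structure making q linear: q = id gives V
  itself, and q = coset P gives V/P, with elements the translates of P.\<close>

definition coset :: "'v::complex_vector set \<Rightarrow> 'v \<Rightarrow> 'v set" where
  "coset P v = (\<lambda>p. v + p) ` P"

definition positive_hermitian_form ::
  "('v::complex_vector \<Rightarrow> 'q) \<Rightarrow> ('q \<Rightarrow> 'q \<Rightarrow> complex) \<Rightarrow> bool" where
  "positive_hermitian_form q H \<longleftrightarrow>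
     (\<forall>u v w. H (q (u + v)) (q w) = H (q u) (q w) + H (q v) (q w)) \<and>
     (\<forall>c v w. H (q (scaleC c v)) (q w) = c * H (q v) (q w)) \<and>
     (\<forall>v w. H (q w) (q v) = cnj (H (q v) (q w))) \<and>
     (\<forall>v. q v \<noteq> q 0 \<longrightarrow> Re (H (q v) (q v)) > 0)"

definition hermitian_metric :: "('v::complex_vector \<Rightarrow> 'q) \<Rightarrow> ('q \<Rightarrow> real) \<Rightarrow> bool" where
  "hermitian_metric q h \<longleftrightarrow>
     (\<exists>H. positive_hermitian_form q H \<and> (\<forall>v. h (q v) = Re (H (q v) (q v))))"

text \<open>Metrics are squares of norms, and so is the dual metric.\<close>

definition dual_metric ::
  "('v::complex_vector \<Rightarrow> 'q) \<Rightarrow> ('q \<Rightarrow> real) \<Rightarrow> ('q \<Rightarrow> complex) \<Rightarrow> real" where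
  "dual_metric q h f = (SUP \<xi>\<in>range q - {q 0}. (cmod (f \<xi>))\<^sup>2 / h \<xi>)"

definition H_metrics :: "('v::complex_vector \<Rightarrow> real) set" where
  "H_metrics = {h. hermitian_metric id h}"


subsection \<open>The line bundle O(1) over the space of hyperplanes\<close>

definition hyperplanes :: "'v::complex_vector set set" where
  "hyperplanes = {P. complex_vector.subspace P \<and>
     complex_vector.dim P + 1 = complex_vector.dim (UNIV :: 'v set)}"

text \<open>The total space of O(1): pairs (P, \<xi>) with \<xi> in V/P. For the trivial bundle with fiber V
  over a subset S of \<open>\<complex>\<^sup>m\<close>, the total space of O(1) is S \<times> O1.\<close>

definition O1 :: "('v::complex_vector set \<times> 'v set) set" where
  "O1 = (SIGMA P:hyperplanes. range (coset P))"

definition metric_on_O1 :: "('v::complex_vector set \<times> 'v set \<Rightarrow> real) \<Rightarrow> bool" where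
  "metric_on_O1 k \<longleftrightarrow> (\<forall>P\<in>hyperplanes. hermitian_metric (coset P) (\<lambda>\<xi>. k (P, \<xi>)))"

text \<open>The metric dual to k, on the dual bundle of O(1), whose fiber over P consists of the linear
  functionals on V/P.\<close>

definition O1_dual_metric ::
  "('v::complex_vector set \<times> 'v set \<Rightarrow> real) \<Rightarrow> 'v set \<times> ('v set \<Rightarrow> complex) \<Rightarrow> real" where
  "O1_dual_metric k = (\<lambda>(P, \<phi>). dual_metric (coset P) (\<lambda>\<xi>. k (P, \<xi>)) \<phi>)"

text \<open>The linear functional on V with coordinates a, in terms of linear coordinates x on V.\<close>

definition functional ::
  "('v::complex_vector \<Rightarrow> complex ^ 'r) \<Rightarrow> complex ^ 'r \<Rightarrow> 'v \<Rightarrow> complex" where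
  "functional x a v = (\<Sum>i\<in>UNIV. a $ i * x v $ i)"

text \<open>The complex structure of the total space of the dual of O(1). A vector $a \ne 0$ gives
  homogeneous coordinates of the hyperplane P = ker f, f = functional x a, and f induces a
  functional on V/P. Let (a, t) represent t times this functional. This is a surjective
  holomorphic submersion of (-{0}) \<times> UNIV onto the total space, so that a function is smooth on
  the total space iff its composition with the map is smooth; and for t = 1 it is a biholomorphism
  of -{0} with the complement of the zero section, i.e. a global chart there.\<close>

definition O1_dual_point ::
  "('v::complex_vector \<Rightarrow> complex ^ 'r) \<Rightarrow> complex ^ 'r \<Rightarrow> complex \<Rightarrow>
     'v set \<times> ('v set \<Rightarrow> complex)" where
  "O1_dual_point x a t =
     (let f = functional x a; P = {v. f v = 0}
      in (P, \<lambda>\<xi>\<in>range (coset P). t * the_elem (f ` \<xi>)))"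

text \<open>Positively curved metrics on O(1), first over a single vector space, then for the trivial
  bundle with fiber V over an open set U. The type argument provides the coordinate space
  \<open>\<complex>\<^sup>r\<close>, where r must be the dimension of V.\<close>

definition positively_curved_O1 ::
  "'r::finite itself \<Rightarrow> ('v::complex_vector set \<times> 'v set \<Rightarrow> real) \<Rightarrow> bool" where
  "positively_curved_O1 _ k \<longleftrightarrow> metric_on_O1 k \<and>
     (\<forall>x :: 'v \<Rightarrow> complex ^ 'r. clinear_iso x \<longrightarrow>
        smooth_on ((-{0}) \<times> UNIV) (\<lambda>(a, t). O1_dual_metric k (O1_dual_point x a t)) \<and>
        strongly_psh_on (-{0}) (\<lambda>a. O1_dual_metric k (O1_dual_point x a 1)))"

definition positively_curved_O1_over ::
  "'r::finite itself \<Rightarrow> (complex ^ 'm) set \<Rightarrow>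
     ((complex ^ 'm) \<times> 'v::complex_vector set \<times> 'v set \<Rightarrow> real) \<Rightarrow> bool" where
  "positively_curved_O1_over _ U k \<longleftrightarrow> (\<forall>s\<in>U. metric_on_O1 (\<lambda>p. k (s, p))) \<and>
     (\<forall>x :: 'v \<Rightarrow> complex ^ 'r. clinear_iso x \<longrightarrow>
        smooth_on (U \<times> (-{0}) \<times> UNIV)
          (\<lambda>(s, a, t). O1_dual_metric (\<lambda>p. k (s, p)) (O1_dual_point x a t)) \<and>
        strongly_psh_on (U \<times> (-{0}))
          (\<lambda>(s, a). O1_dual_metric (\<lambda>p. k (s, p)) (O1_dual_point x a 1)))"

text \<open>Extensionality makes elements of K_metrics functions on the total space O1 only.\<close>

definition K_metrics ::
  "'r::finite itself \<Rightarrow> ('v::complex_vector set \<times> 'v set \<Rightarrow> real) set" where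
  "K_metrics R = {k \<in> extensional O1. positively_curved_O1 R k}"


subsection \<open>Metrics on the trivial bundle\<close>

definition metric_over :: "'s set \<Rightarrow> ('s \<times> 'v::complex_vector \<Rightarrow> real) \<Rightarrow> bool" where
  "metric_over A h \<longleftrightarrow> (\<forall>s\<in>A. hermitian_metric id (\<lambda>v. h (s, v)))"

definition smooth_metric_over ::
  "'r::finite itself \<Rightarrow> (complex ^ 'm) set \<Rightarrow>
     ((complex ^ 'm) \<times> 'v::complex_vector \<Rightarrow> real) \<Rightarrow> bool" where
  "smooth_metric_over _ A h \<longleftrightarrow> metric_over A h \<and>
     (\<forall>y :: complex ^ 'r \<Rightarrow> 'v. clinear_iso y \<longrightarrow> smooth_on (A \<times> UNIV) (\<lambda>(s, z). h (s, y z)))"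

text \<open>Semipositive curvature over an open set U: the dual metric is plurisubharmonic on the total
  space of the dual bundle.\<close>

definition semipositively_curved_over ::
  "'r::finite itself \<Rightarrow> (complex ^ 'm) set \<Rightarrow>
     ((complex ^ 'm) \<times> 'v::complex_vector \<Rightarrow> real) \<Rightarrow> bool" where
  "semipositively_curved_over _ U h \<longleftrightarrow>
     (\<forall>x :: 'v \<Rightarrow> complex ^ 'r. clinear_iso x \<longrightarrow>
        psh_on (U \<times> UNIV) (\<lambda>(s, a). dual_metric id (\<lambda>v. h (s, v)) (functional x a)))"

text \<open>The metric $k_h$ on O(1); LEAST is the minimum of h over the translate \<xi> of P.\<close>

definition k_of ::
  "('s \<times> 'v::complex_vector \<Rightarrow> real) \<Rightarrow> 's \<times> 'v set \<times> 'v set \<Rightarrow> real" where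
  "k_of h = (\<lambda>(s, P, \<xi>). LEAST y. y \<in> (\<lambda>v. h (s, v)) ` \<xi>)"


subsection \<open>Equivariant maps\<close>

definition pull_H ::
  "('w::complex_vector \<Rightarrow> 'v::complex_vector) \<Rightarrow> ('v \<Rightarrow> real) \<Rightarrow> ('w \<Rightarrow> real)" where
  "pull_H \<phi> h = h \<circ> \<phi>"

definition pull_K ::
  "('w::complex_vector \<Rightarrow> 'v::complex_vector) \<Rightarrow> ('v set \<times> 'v set \<Rightarrow> real) \<Rightarrow>
     ('w set \<times> 'w set \<Rightarrow> real)" where
  "pull_K \<phi> k = (\<lambda>(P, \<xi>)\<in>O1. k (\<phi> ` P, \<phi> ` \<xi>))"

definition GL_equivariant ::
  "(((complex ^ 'r) set \<times> (complex ^ 'r) set \<Rightarrow> real) \<Rightarrow> (complex ^ 'r \<Rightarrow> real)) \<Rightarrow> bool" where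
  "GL_equivariant \<Psi> \<longleftrightarrow> \<Psi> \<in> K_metrics TYPE('r) \<rightarrow> H_metrics \<and>
     (\<forall>\<phi> :: complex ^ 'r \<Rightarrow> complex ^ 'r. clinear_iso \<phi> \<longrightarrow>
        (\<forall>k\<in>K_metrics TYPE('r). pull_H \<phi> (\<Psi> k) = \<Psi> (pull_K \<phi> k)))"

text \<open>The map $\Psi_V$; for equivariant $\Psi$ it is independent of the choice of $\psi$.
  The inverse of pull_H $\psi$ is pull_H (inv $\psi$).\<close>

definition transfer_map ::
  "(((complex ^ 'r) set \<times> (complex ^ 'r) set \<Rightarrow> real) \<Rightarrow> (complex ^ 'r \<Rightarrow> real)) \<Rightarrow>
     ('v::complex_vector set \<times> 'v set \<Rightarrow> real) \<Rightarrow> ('v \<Rightarrow> real)" where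
  "transfer_map \<Psi> k =
     (let \<psi> = (SOME \<psi> :: complex ^ 'r \<Rightarrow> 'v. clinear_iso \<psi>)
      in pull_H (inv \<psi>) (\<Psi> (pull_K \<psi> k)))"

definition fiberwise_map ::
  "(((complex ^ 'r) set \<times> (complex ^ 'r) set \<Rightarrow> real) \<Rightarrow> (complex ^ 'r \<Rightarrow> real)) \<Rightarrow>
     ('s \<times> 'v::complex_vector set \<times> 'v set \<Rightarrow> real) \<Rightarrow> ('s \<times> 'v \<Rightarrow> real)" where
  "fiberwise_map \<Psi> k = (\<lambda>(s, v). transfer_map \<Psi> (\<lambda>p\<in>O1. k (s, p)) v)"

end

theory Submission
  imports Defs
begin

text \<open>
  A metric k on O(1) with positive curvature is the same as its dual N(s, a), a function of s and of
  the homogeneous coordinates a of a hyperplane that is homogeneous of bidegree (1, 1) in a, positive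
  and strongly plurisubharmonic; k is some \<open>k_h\<close> exactly where N is a hermitian form in a.
  The unit vectors \<open>e_l\<close> being the coordinate vectors, fix indices i, j and put
  \<open>M(a) = |a|\<^sup>2 + \<epsilon> (\<Sum>l. |a_l|^4) / |a|\<^sup>2\<close>. Since M is invariant under permutations and sign changes of the
  coordinates, an equivariant map sends it to a multiple of the standard hermitian metric; so it is
  determined, up to one constant, on all metrics with dual M(g a), g linear, and the dual of the image
  is a multiple of \<open>|g a|\<^sup>2\<close>. The example has the dual M(g a) at the centre, with g unitary and moving
  \<open>e_i\<close> to a point where the quartic term is small, and on the circle |s| = 1/2 the dual
  \<open>(1 - \<epsilon>/4) M(D a)\<close> with D fixing \<open>e_i\<close>. At \<open>a = e_i\<close> the function N increases from the centre to the
  circle, but the hermitian part drops by the factor \<open>1 - \<epsilon>/4\<close>, which violates the sub-mean value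
  inequality for the image. Strong plurisubharmonicity: N is an \<open>\<epsilon>\<close>-perturbation of a plurisubharmonic
  family of hermitian forms (stretching the directions other than \<open>e_i\<close>, and flat in the direction
  \<open>e_i\<close> for \<open>|s|\<^sup>2 \<le> 1/2\<close>) whose Levi form has as kernel precisely the s-directions at
  \<open>a\<close> parallel to \<open>e_i\<close> and \<open>|s|\<^sup>2 \<le> 1/2\<close>; there the perturbation has positive Levi form, and compactness gives a
  suitable \<open>\<epsilon>\<close>. The perturbation is cut off where the family is strongly plurisubharmonic.
\<close>

subsection \<open>Smooth functions\<close>

lemma frechet_derivative_cong_open:
  assumes "open U" "\<And>x. x \<in> U \<Longrightarrow> f x = g x" "x \<in> U"
  shows "frechet_derivative f (at x) = frechet_derivative g (at x)"
proof -
  have "(f has_derivative f') (at x) \<longleftrightarrow> (g has_derivative f') (at x)" for f'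
    by (metis assms has_derivative_transform_within_open)
  then show ?thesis by (simp add: frechet_derivative_def)
qed

lemma C_k_on_cong:
  assumes "open U" "\<And>x. x \<in> U \<Longrightarrow> f x = g x"
  shows "C_k_on k U f \<longleftrightarrow> C_k_on k U g"
  using assms(2)
proof (induction k arbitrary: f g)
  case 0
  then show ?case by (simp cong: continuous_on_cong)
next
  case (Suc k)
  have "f differentiable_on U \<longleftrightarrow> g differentiable_on U"
    unfolding differentiable_on_def
    by (metis Suc.prems differentiable_transform_within zero_less_one)
  moreover have "C_k_on k U (\<lambda>x. frechet_derivative f (at x) v) \<longleftrightarrow>
      C_k_on k U (\<lambda>x. frechet_derivative g (at x) v)" for v
    using frechet_derivative_cong_open[OF assms(1) Suc.prems] by (intro Suc.IH) simp
  ultimately show ?case by simp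
qed

lemma C_k_on_SucI:
  assumes "open U" "\<And>x. x \<in> U \<Longrightarrow> (f has_derivative f' x) (at x)"
    and "\<And>v. C_k_on k U (\<lambda>x. f' x v)"
  shows "C_k_on (Suc k) U f"
proof -
  have "f differentiable_on U"
    unfolding differentiable_on_def
    using assms(2) differentiable_at_withinI differentiable_def by blast
  moreover have "C_k_on k U (\<lambda>x. frechet_derivative f (at x) v)" for v
    using assms(3)[of v] frechet_derivative_at[OF assms(2)]
    by (subst C_k_on_cong[OF \<open>open U\<close>, where g = "\<lambda>x. f' x v"]) auto
  ultimately show ?thesis by simp
qed

lemma C_k_on_SucD:
  assumes "C_k_on (Suc k) U f"
  shows "C_k_on k U f"
  using assms
proof (induction k arbitrary: f)
  case 0
  then show ?case by (simp add: differentiable_imp_continuous_on)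
qed auto

lemma C_k_on_has_derivative:
  assumes "C_k_on (Suc k) U f" "open U" "x \<in> U"
  shows "(f has_derivative frechet_derivative f (at x)) (at x)"
proof -
  have "f differentiable at x within U"
    using assms by (simp add: differentiable_on_def)
  then show ?thesis
    by (simp add: at_within_open[OF assms(3,2)] frechet_derivative_works)
qed

lemma C_k_on_const: "C_k_on k U (\<lambda>x. c)"
  by (induction k arbitrary: c) auto

lemma C_k_on_bounded_linear:
  assumes "bounded_linear f" "open U"
  shows "C_k_on k U f"
proof (cases k)
  case 0
  then show ?thesis using assms by (simp add: linear_continuous_on)
next
  case (Suc n)
  show ?thesis unfolding Suc
    using assms by (intro C_k_on_SucI[where f' = "\<lambda>x. f"])
      (auto intro: bounded_linear_imp_has_derivative C_k_on_const)
qed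

lemma C_k_on_add:
  assumes "open U" "C_k_on k U f" "C_k_on k U g"
  shows "C_k_on k U (\<lambda>x. f x + g x)"
  using assms(2,3)
proof (induction k arbitrary: f g)
  case 0
  then show ?case by (simp add: continuous_on_add)
next
  case (Suc k)
  show ?case
    by (rule C_k_on_SucI[OF \<open>open U\<close>
          has_derivative_add[OF C_k_on_has_derivative[OF Suc.prems(1) \<open>open U\<close>]
            C_k_on_has_derivative[OF Suc.prems(2) \<open>open U\<close>]]])
      (use Suc in auto)
qed

lemma C_k_on_mult:
  assumes "open U" "C_k_on k U f" "C_k_on k U g"
  shows "C_k_on k U (\<lambda>x. f x * g x)"
  using assms(2,3)
proof (induction k arbitrary: f g)
  case 0
  then show ?case by (simp add: continuous_on_mult)
next
  case (Suc k)
  show ?case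
  proof (rule C_k_on_SucI[OF \<open>open U\<close>])
    show "((\<lambda>x. f x * g x) has_derivative
      (\<lambda>v. f x * frechet_derivative g (at x) v + frechet_derivative f (at x) v * g x)) (at x)"
      if "x \<in> U" for x
      using that Suc.prems by (intro has_derivative_mult C_k_on_has_derivative[OF _ \<open>open U\<close>])
    show "C_k_on k U (\<lambda>x. f x * frechet_derivative g (at x) v + frechet_derivative f (at x) v * g x)"
      for v
      using Suc.prems C_k_on_SucD[OF Suc.prems(1)] C_k_on_SucD[OF Suc.prems(2)]
      by (intro C_k_on_add[OF \<open>open U\<close>] Suc.IH) auto
  qed
qed

lemma C_k_on_inverse:
  assumes "open U" "C_k_on k U f" "\<And>x. x \<in> U \<Longrightarrow> f x \<noteq> 0"
  shows "C_k_on k U (\<lambda>x. inverse (f x))"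
  using assms(2,3)
proof (induction k arbitrary: f)
  case 0
  then show ?case by (simp add: continuous_on_inverse)
next
  case (Suc k)
  show ?case
  proof (rule C_k_on_SucI[OF \<open>open U\<close>])
    show "((\<lambda>x. inverse (f x)) has_derivative
      (\<lambda>v. - 1 * (inverse (f x) * frechet_derivative f (at x) v * inverse (f x)))) (at x)"
      if "x \<in> U" for x
      using Deriv.has_derivative_inverse[OF Suc.prems(2)[OF that]
          C_k_on_has_derivative[OF Suc.prems(1) \<open>open U\<close> that]]
      by simp
    have "C_k_on k U (\<lambda>x. inverse (f x))"
      using Suc.IH C_k_on_SucD[OF Suc.prems(1)] Suc.prems(2) by blast
    then show "C_k_on k U
      (\<lambda>x. - 1 * (inverse (f x) * frechet_derivative f (at x) v * inverse (f x)))" for v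
      using Suc.prems(1) by (intro C_k_on_mult[OF \<open>open U\<close>] C_k_on_const) auto
  qed
qed

lemma C_k_on_affine_compose:
  assumes "open U" "open V" "bounded_linear L" "\<And>x. x \<in> V \<Longrightarrow> L x + c \<in> U" "C_k_on k U f"
  shows "C_k_on k V (\<lambda>x. f (L x + c))"
  using assms(5)
proof (induction k arbitrary: f)
  case 0
  have "continuous_on V (\<lambda>x. L x + c)"
    using assms(3) by (intro continuous_intros linear_continuous_on)
  with 0 show ?case
    using assms(4) by (auto intro: continuous_on_compose2)
next
  case (Suc k)
  show ?case
  proof (rule C_k_on_SucI[OF \<open>open V\<close>])
    show "((\<lambda>x. f (L x + c)) has_derivative (\<lambda>v. frechet_derivative f (at (L x + c)) (L v))) (at x)"
      if "x \<in> V" for x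
    proof (rule has_derivative_compose[where f = "\<lambda>x. L x + c" and g = f])
      show "((\<lambda>x. L x + c) has_derivative L) (at x)"
        using bounded_linear_imp_has_derivative[OF assms(3)] by (rule has_derivative_add_const)
      show "(f has_derivative frechet_derivative f (at (L x + c))) (at (L x + c))"
        using C_k_on_has_derivative[OF Suc.prems \<open>open U\<close> assms(4)[OF that]] .
    qed
    show "C_k_on k V (\<lambda>x. frechet_derivative f (at (L x + c)) (L v))" for v
      using Suc by auto
  qed
qed

text \<open>The functions \<open>exp (-1/x) / x ^ n\<close>, extended by zero to the left: this family is closed
  under differentiation up to linear combinations.\<close>

definition flat :: "nat \<Rightarrow> real \<Rightarrow> real" where
  "flat n x = (if x > 0 then exp (- (1 / x)) / x ^ n else 0)"

lemma flat_tendsto_0: "(flat n \<longlongrightarrow> 0) (at_right 0)"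
proof -
  have "((\<lambda>x::real. inverse x ^ n / exp (inverse x)) \<longlongrightarrow> 0) (at_right 0)"
    by (intro filterlim_compose[OF tendsto_power_div_exp_0] filterlim_inverse_at_top_right)
  moreover have "eventually (\<lambda>x. inverse x ^ n / exp (inverse x) = flat n x) (at_right 0)"
    unfolding eventually_at_right_field
    by (rule exI[of _ 1]) (auto simp: flat_def exp_minus field_simps)
  ultimately show ?thesis by (rule Lim_transform_eventually)
qed

lemma flat_has_derivative:
  "(flat n has_real_derivative flat (n + 2) x - real n * flat (Suc n) x) (at x)"
proof -
  consider "x > 0" | "x < 0" | "x = 0" by linarith
  then show ?thesis
  proof cases
    case 1
    let ?y = "inverse x"
    have "((\<lambda>x. exp (- inverse x) * inverse x ^ n) has_real_derivative
        exp (- ?y) * ?y\<^sup>2 * ?y ^ n - exp (- ?y) * (real n * ?y ^ (n - 1) * ?y\<^sup>2)) (at x)"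
      using 1 by (auto intro!: derivative_eq_intros simp: power2_eq_square)
    moreover have "exp (- ?y) * ?y\<^sup>2 * ?y ^ n - exp (- ?y) * (real n * ?y ^ (n - 1) * ?y\<^sup>2) =
        flat (n + 2) x - real n * flat (Suc n) x"
      using 1 by (cases n)
        (simp_all add: flat_def divide_inverse power_inverse power2_eq_square mult_ac)
    ultimately have "((\<lambda>x. exp (- inverse x) * inverse x ^ n) has_real_derivative
        flat (n + 2) x - real n * flat (Suc n) x) (at x)"
      by simp
    then show ?thesis
      by (rule has_field_derivative_transform_within_open[of _ _ _ "{0<..}"])
        (use 1 in \<open>auto simp: flat_def divide_inverse power_inverse\<close>)
  next
    case 2
    have "((\<lambda>x. 0) has_real_derivative flat (n + 2) x - real n * flat (Suc n) x) (at x)"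
      using 2 by (simp add: flat_def)
    then show ?thesis
      by (rule has_field_derivative_transform_within_open[of _ _ _ "{..<0}"])
        (use 2 in \<open>auto simp: flat_def\<close>)
  next
    case 3
    have "((\<lambda>y. (flat n y - flat n 0) / (y - 0)) \<longlongrightarrow> 0) (at_right 0)"
      by (rule Lim_transform_eventually[OF flat_tendsto_0[of "Suc n"]])
        (auto simp: eventually_at_right_field flat_def intro!: exI[of _ 1])
    moreover have "((\<lambda>y. (flat n y - flat n 0) / (y - 0)) \<longlongrightarrow> 0) (at_left 0)"
      by (rule Lim_transform_eventually[OF tendsto_const])
        (auto simp: eventually_at_left_field flat_def intro!: exI[of _ "-1"])
    ultimately show ?thesis
      unfolding 3 has_field_derivative_iff by (simp add: flat_def filterlim_split_at)
  qed
qed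

lemma C_k_on_flat:
  assumes "open U" "C_k_on k U f"
  shows "C_k_on k U (\<lambda>x. flat n (f x))"
  using assms(2)
proof (induction k arbitrary: n)
  case 0
  have "continuous_on UNIV (flat n)"
    using flat_has_derivative DERIV_isCont continuous_at_imp_continuous_on by blast
  with 0 show ?case
    by (auto intro: continuous_on_compose2)
next
  case (Suc k)
  show ?case
  proof (rule C_k_on_SucI[OF \<open>open U\<close>])
    show "((\<lambda>x. flat n (f x)) has_derivative
      (\<lambda>v. frechet_derivative f (at x) v * (flat (n + 2) (f x) + - real n * flat (Suc n) (f x)))) (at x)"
      if "x \<in> U" for x
      using has_derivative_compose[OF C_k_on_has_derivative[OF Suc.prems \<open>open U\<close> that]
          has_field_derivative_imp_has_derivative[OF flat_has_derivative[of n "f x"]]]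
      by (simp add: mult.commute)
    show "C_k_on k U
      (\<lambda>x. frechet_derivative f (at x) v * (flat (n + 2) (f x) + - real n * flat (Suc n) (f x)))" for v
      using Suc.prems C_k_on_SucD[OF Suc.prems]
      by (intro C_k_on_mult[OF \<open>open U\<close>] C_k_on_add[OF \<open>open U\<close>] C_k_on_const Suc.IH) auto
  qed
qed

definition C_inf_on :: "'a set \<Rightarrow> ('a::euclidean_space \<Rightarrow> real) \<Rightarrow> bool" where
  "C_inf_on U f \<longleftrightarrow> open U \<and> (\<forall>k. C_k_on k U f)"

lemma C_inf_on_const: "open U \<Longrightarrow> C_inf_on U (\<lambda>x. c)"
  by (simp add: C_inf_on_def C_k_on_const)

lemma C_inf_on_add:
  "C_inf_on U f \<Longrightarrow> C_inf_on U g \<Longrightarrow> C_inf_on U (\<lambda>x. f x + g x)"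
  by (simp add: C_inf_on_def C_k_on_add)

lemma C_inf_on_mult:
  "C_inf_on U f \<Longrightarrow> C_inf_on U g \<Longrightarrow> C_inf_on U (\<lambda>x. f x * g x)"
  by (simp add: C_inf_on_def C_k_on_mult)

lemma C_inf_on_diff:
  "C_inf_on U f \<Longrightarrow> C_inf_on U g \<Longrightarrow> C_inf_on U (\<lambda>x. f x - g x)"
  using C_inf_on_add[of U f "\<lambda>x. - 1 * g x"] C_inf_on_mult[of U "\<lambda>x. - 1" g]
  by (simp add: C_inf_on_def C_k_on_const)

lemma C_inf_on_divide:
  "C_inf_on U f \<Longrightarrow> C_inf_on U g \<Longrightarrow> (\<And>x. x \<in> U \<Longrightarrow> g x \<noteq> 0) \<Longrightarrow> C_inf_on U (\<lambda>x. f x / g x)"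
  by (simp add: C_inf_on_def divide_inverse C_k_on_mult C_k_on_inverse)

lemma C_inf_on_power: "C_inf_on U f \<Longrightarrow> C_inf_on U (\<lambda>x. f x ^ n)"
  by (induction n) (auto simp: C_inf_on_def C_k_on_const C_k_on_mult)

lemma C_inf_on_sum:
  "open U \<Longrightarrow> (\<And>i. i \<in> A \<Longrightarrow> C_inf_on U (f i)) \<Longrightarrow> C_inf_on U (\<lambda>x. \<Sum>i\<in>A. f i x)"
  by (induction A rule: infinite_finite_induct) (auto intro!: C_inf_on_const C_inf_on_add)

lemma C_inf_on_flat: "C_inf_on U f \<Longrightarrow> C_inf_on U (\<lambda>x. flat n (f x))"
  by (simp add: C_inf_on_def C_k_on_flat)

lemma C_inf_on_norm_square:
  fixes L :: "'a::euclidean_space \<Rightarrow> 'b::euclidean_space"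
  assumes "bounded_linear L" "open U"
  shows "C_inf_on U (\<lambda>x. (norm (L x))\<^sup>2)"
proof -
  have "C_inf_on U (\<lambda>x. \<Sum>b\<in>Basis. (L x \<bullet> b)\<^sup>2)"
    using assms
    by (intro C_inf_on_sum C_inf_on_power)
      (auto simp: C_inf_on_def
        intro!: C_k_on_bounded_linear bounded_linear_compose[OF bounded_linear_inner_left])
  moreover have "(norm (L x))\<^sup>2 = (\<Sum>b\<in>Basis. (L x \<bullet> b)\<^sup>2)" for x
    by (subst norm_eq_sqrt_inner, subst euclidean_inner) (simp add: sum_nonneg power2_eq_square)
  ultimately show ?thesis by simp
qed

lemma C_inf_on_affine_compose:
  assumes "C_inf_on U f" "open V" "bounded_linear L" "\<And>x. x \<in> V \<Longrightarrow> L x + c \<in> U"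
  shows "C_inf_on V (\<lambda>x. f (L x + c))"
  using assms by (auto simp: C_inf_on_def intro: C_k_on_affine_compose)

lemmas C_inf_on_linear_compose = C_inf_on_affine_compose[where c = 0, simplified]

lemma C_inf_on_imp_smooth_on:
  assumes "C_inf_on U f" "A \<subseteq> U" "\<And>x. x \<in> A \<Longrightarrow> g x = f x"
  shows "smooth_on A g"
  unfolding smooth_on_def
  using assms by (auto simp: C_inf_on_def intro!: exI[of _ U] exI[of _ f])

subsection \<open>The Levi form\<close>

definition second_deriv :: "('a::euclidean_space \<Rightarrow> real) \<Rightarrow> 'a \<Rightarrow> 'a \<Rightarrow> real" where
  "second_deriv u x v = frechet_derivative (\<lambda>y. frechet_derivative u (at y) v) (at x) v"

lemma levi_form_second_deriv:
  "levi_form u x w = (second_deriv u x w + second_deriv u x (scaleC \<i> w)) / 4"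
  by (simp add: levi_form_def second_deriv_def)

lemma frechet_derivative_eqI:
  "(f has_derivative f') (at x) \<Longrightarrow> frechet_derivative f (at x) v = f' v"
  using frechet_derivative_at[of f f' x] by simp

lemma C_inf_on_has_derivative:
  "C_inf_on U f \<Longrightarrow> x \<in> U \<Longrightarrow> (f has_derivative frechet_derivative f (at x)) (at x)"
  using C_k_on_has_derivative[of 0 U f x] unfolding C_inf_on_def by blast

lemma C_inf_on_frechet_derivative:
  assumes "C_inf_on U f"
  shows "C_inf_on U (\<lambda>x. frechet_derivative f (at x) v)"
proof -
  have "C_k_on k U (\<lambda>x. frechet_derivative f (at x) v)" for k
  proof -
    have "C_k_on (Suc k) U f" using assms unfolding C_inf_on_def by blast
    then show ?thesis by simp
  qed
  then show ?thesis using assms by (simp add: C_inf_on_def)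
qed

lemma C_inf_on_imp_continuous_on: "C_inf_on U f \<Longrightarrow> continuous_on U f"
  unfolding C_inf_on_def using C_k_on.simps(1) by blast

lemma has_real_derivative_on_line:
  fixes f :: "'a::euclidean_space \<Rightarrow> real"
  assumes "(f has_derivative f') (at (x + t *\<^sub>R v))"
  shows "((\<lambda>t. f (x + t *\<^sub>R v)) has_real_derivative f' v) (at t)"
proof -
  have "((\<lambda>t. x + t *\<^sub>R v) has_derivative (\<lambda>h. h *\<^sub>R v)) (at t)"
    by (auto intro!: derivative_eq_intros)
  from has_derivative_compose[OF this assms]
  have "((\<lambda>t. f (x + t *\<^sub>R v)) has_derivative (\<lambda>h. f' (h *\<^sub>R v))) (at t)" .
  moreover have "f' (h *\<^sub>R v) = f' v * h" for h
    using linear_scale[OF has_derivative_linear[OF assms]] by simp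
  ultimately show ?thesis
    unfolding has_field_derivative_def by simp
qed

lemma second_deriv_eq_deriv:
  assumes "C_inf_on U u" "x \<in> U"
  shows "second_deriv u x v = deriv (deriv (\<lambda>t. u (x + t *\<^sub>R v))) 0"
proof -
  let ?g = "\<lambda>y. frechet_derivative u (at y) v"
  have "open U" using assms by (simp add: C_inf_on_def)
  have "deriv (\<lambda>t. u (x + t *\<^sub>R v)) t = ?g (x + t *\<^sub>R v)" if "x + t *\<^sub>R v \<in> U" for t
    by (intro DERIV_imp_deriv has_real_derivative_on_line C_inf_on_has_derivative[OF assms(1) that])
  moreover have "eventually (\<lambda>t. x + t *\<^sub>R v \<in> U) (nhds 0)"
  proof -
    have "((\<lambda>t. x + t *\<^sub>R v) \<longlongrightarrow> x + 0 *\<^sub>R v) (nhds 0)"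
      by (intro tendsto_intros filterlim_ident)
    then show ?thesis using \<open>open U\<close> assms(2) by (auto dest: topological_tendstoD)
  qed
  ultimately have "eventually (\<lambda>t. deriv (\<lambda>t. u (x + t *\<^sub>R v)) t = ?g (x + t *\<^sub>R v)) (nhds 0)"
    by (auto elim: eventually_mono)
  then have "deriv (deriv (\<lambda>t. u (x + t *\<^sub>R v))) 0 = deriv (\<lambda>t. ?g (x + t *\<^sub>R v)) 0"
    by (rule deriv_cong_ev) simp
  also have "\<dots> = second_deriv u x v"
    unfolding second_deriv_def
    using assms by (intro DERIV_imp_deriv has_real_derivative_on_line)
      (auto intro!: C_inf_on_has_derivative C_inf_on_frechet_derivative)
  finally show ?thesis ..
qed

lemma second_deriv_eqI:
  assumes "C_inf_on U u" "x \<in> U" "d > 0" "\<And>t. \<bar>t\<bar> < d \<Longrightarrow> u (x + t *\<^sub>R v) = G t"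
    and "\<And>t. (G has_real_derivative G' t) (at t)" "(G' has_real_derivative D) (at 0)"
  shows "second_deriv u x v = D"
proof -
  have ev: "eventually (\<lambda>t. \<bar>t\<bar> < d) (nhds (0::real))"
    using assms(3) by (auto simp: eventually_nhds_metric dist_real_def)
  have "eventually (\<lambda>t. deriv (\<lambda>t. u (x + t *\<^sub>R v)) t = G' t) (nhds 0)"
  proof (rule eventually_mono[OF ev])
    fix t :: real assume t: "\<bar>t\<bar> < d"
    have "eventually (\<lambda>t. t \<in> {-d<..<d}) (nhds t)"
      using t by (intro eventually_nhds_in_open) auto
    then have "eventually (\<lambda>t. u (x + t *\<^sub>R v) = G t) (nhds t)"
      by (rule eventually_mono) (auto simp: assms(4) abs_less_iff)
    then have "deriv (\<lambda>t. u (x + t *\<^sub>R v)) t = deriv G t" by (rule deriv_cong_ev) simp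
    then show "deriv (\<lambda>t. u (x + t *\<^sub>R v)) t = G' t"
      unfolding DERIV_imp_deriv[OF assms(5)] .
  qed
  then have "deriv (deriv (\<lambda>t. u (x + t *\<^sub>R v))) 0 = deriv G' 0"
    by (rule deriv_cong_ev) simp
  then show ?thesis
    unfolding second_deriv_eq_deriv[OF assms(1,2)] DERIV_imp_deriv[OF assms(6)] .
qed

lemma levi_form_affine_compose:
  fixes L :: "'a::{complex_vector,euclidean_space} \<Rightarrow> 'b::{complex_vector,euclidean_space}"
  assumes "C_inf_on U u" "bounded_linear L" "\<And>w. L (scaleC \<i> w) = scaleC \<i> (L w)" "L x + c \<in> U"
  shows "levi_form (\<lambda>y. u (L y + c)) x w = levi_form u (L x + c) (L w)"
proof -
  let ?V = "(\<lambda>y. L y + c) -` U"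
  have "open ?V"
    using assms(1) linear_continuous_on[OF assms(2)]
    by (intro open_vimage continuous_intros) (simp_all add: C_inf_on_def)
  then have C: "C_inf_on ?V (\<lambda>y. u (L y + c))"
    using C_inf_on_affine_compose[OF assms(1) _ assms(2)] by blast
  have x: "x \<in> ?V" using assms(4) by simp
  have "L (x + t *\<^sub>R v) + c = (L x + c) + t *\<^sub>R L v" for t v
    using linear_add[OF bounded_linear.linear[OF assms(2)]]
      linear_scale[OF bounded_linear.linear[OF assms(2)]] by simp
  then have "second_deriv (\<lambda>y. u (L y + c)) x v = second_deriv u (L x + c) (L v)" for v
    unfolding second_deriv_eq_deriv[OF assms(1,4)] second_deriv_eq_deriv[OF C x] by (simp only:)
  then show ?thesis by (simp only: levi_form_second_deriv assms(3))
qed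

lemmas levi_form_linear_compose = levi_form_affine_compose[where c = 0, simplified]

lemma levi_form_cong_open:
  assumes "open U" "\<And>y. y \<in> U \<Longrightarrow> u y = v y" "x \<in> U"
  shows "levi_form u x w = levi_form v x w"
proof -
  have "second_deriv u x a = second_deriv v x a" for a
    unfolding second_deriv_def
    using frechet_derivative_cong_open[OF assms(1), of u v] assms
    by (subst frechet_derivative_cong_open[OF assms(1), where g = "\<lambda>y. frechet_derivative v (at y) a"])
      auto
  then show ?thesis by (simp add: levi_form_second_deriv)
qed

lemma second_deriv_add:
  assumes "C_inf_on U u" "C_inf_on U v" "x \<in> U"
  shows "second_deriv (\<lambda>y. u y + v y) x w = second_deriv u x w + second_deriv v x w"
proof -
  let ?D = "\<lambda>f y. frechet_derivative f (at y) w"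
  have 1: "?D (\<lambda>y. u y + v y) y = ?D u y + ?D v y" if "y \<in> U" for y
    by (rule frechet_derivative_eqI[OF has_derivative_add[OF
          C_inf_on_has_derivative[OF assms(1) that] C_inf_on_has_derivative[OF assms(2) that]]])
  have "((\<lambda>y. ?D u y + ?D v y) has_derivative
      (\<lambda>h. frechet_derivative (?D u) (at x) h + frechet_derivative (?D v) (at x) h)) (at x)"
    using assms by (intro has_derivative_add C_inf_on_has_derivative C_inf_on_frechet_derivative)
  then have "(?D (\<lambda>y. u y + v y) has_derivative
      (\<lambda>h. frechet_derivative (?D u) (at x) h + frechet_derivative (?D v) (at x) h)) (at x)"
    by (rule has_derivative_transform_within_open[of _ _ _ _ U])
      (use assms 1 in \<open>auto simp: C_inf_on_def\<close>)
  then show ?thesis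
    unfolding second_deriv_def by (rule frechet_derivative_eqI)
qed

lemma levi_form_add:
  assumes "C_inf_on U u" "C_inf_on U v" "x \<in> U"
  shows "levi_form (\<lambda>y. u y + v y) x w = levi_form u x w + levi_form v x w"
  using second_deriv_add[OF assms] by (simp add: levi_form_second_deriv field_simps)

lemma second_deriv_cmult:
  assumes "C_inf_on U u" "x \<in> U"
  shows "second_deriv (\<lambda>y. c * u y) x w = c * second_deriv u x w"
proof -
  let ?D = "\<lambda>f y. frechet_derivative f (at y) w"
  have 1: "?D (\<lambda>y. c * u y) y = c * ?D u y" if "y \<in> U" for y
    by (rule frechet_derivative_eqI[OF has_derivative_mult_right[OF
          C_inf_on_has_derivative[OF assms(1) that]]])
  have "((\<lambda>y. c * ?D u y) has_derivative
      (\<lambda>h. c * frechet_derivative (?D u) (at x) h)) (at x)"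
    using assms
    by (intro has_derivative_mult_right C_inf_on_has_derivative C_inf_on_frechet_derivative)
  then have "(?D (\<lambda>y. c * u y) has_derivative
      (\<lambda>h. c * frechet_derivative (?D u) (at x) h)) (at x)"
    by (rule has_derivative_transform_within_open[of _ _ _ _ U])
      (use assms 1 in \<open>auto simp: C_inf_on_def\<close>)
  then show ?thesis
    unfolding second_deriv_def by (rule frechet_derivative_eqI)
qed

lemma levi_form_cmult:
  assumes "C_inf_on U u" "x \<in> U"
  shows "levi_form (\<lambda>y. c * u y) x w = c * levi_form u x w"
  using second_deriv_cmult[OF assms] by (simp add: levi_form_second_deriv field_simps)

lemma frechet_derivative_expand:
  fixes f :: "'a::euclidean_space \<Rightarrow> real"
  assumes "(f has_derivative frechet_derivative f (at x)) (at x)"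
  shows "frechet_derivative f (at x) v = (\<Sum>i\<in>Basis. (v \<bullet> i) * frechet_derivative f (at x) i)"
  using Linear_Algebra.linear_componentwise[OF has_derivative_linear[OF assms], of v 1] by simp

lemma second_deriv_expand:
  fixes u :: "'a::euclidean_space \<Rightarrow> real"
  assumes "C_inf_on U u" "x \<in> U"
  shows "second_deriv u x v = (\<Sum>i\<in>Basis. \<Sum>j\<in>Basis.
    (v \<bullet> i) * (v \<bullet> j) * frechet_derivative (\<lambda>y. frechet_derivative u (at y) i) (at x) j)"
proof -
  let ?D = "\<lambda>v y. frechet_derivative u (at y) v"
  have "((\<lambda>y. \<Sum>i\<in>Basis. (v \<bullet> i) * ?D i y) has_derivative
      (\<lambda>h. \<Sum>i\<in>Basis. (v \<bullet> i) * frechet_derivative (?D i) (at x) h)) (at x)"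
    using assms
    by (intro has_derivative_sum has_derivative_mult_right C_inf_on_has_derivative
        C_inf_on_frechet_derivative)
  then have "(?D v has_derivative
      (\<lambda>h. \<Sum>i\<in>Basis. (v \<bullet> i) * frechet_derivative (?D i) (at x) h)) (at x)"
    by (rule has_derivative_transform_within_open[of _ _ _ _ U])
      (use assms frechet_derivative_expand[OF C_inf_on_has_derivative[OF assms(1)], of _ v]
        in \<open>auto simp: C_inf_on_def\<close>)
  then have "second_deriv u x v = (\<Sum>i\<in>Basis. (v \<bullet> i) * frechet_derivative (?D i) (at x) v)"
    unfolding second_deriv_def by (rule frechet_derivative_eqI)
  also have "\<dots> = (\<Sum>i\<in>Basis. (v \<bullet> i) *
      (\<Sum>j\<in>Basis. (v \<bullet> j) * frechet_derivative (?D i) (at x) j))"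
    using assms
    by (intro sum.cong refl arg_cong2[where f = "(*)"] frechet_derivative_expand
        C_inf_on_has_derivative C_inf_on_frechet_derivative)
  finally show ?thesis by (simp add: sum_distrib_left mult.assoc)
qed

lemma linear_scaleC: "linear (scaleC c :: 'a::complex_vector \<Rightarrow> 'a)"
  by (rule linearI) (simp_all add: scaleC_add_right scaleR_scaleC scaleC_scaleC mult.commute)

lemma bounded_linear_scaleC: "bounded_linear (scaleC c :: 'a::{complex_vector,euclidean_space} \<Rightarrow> 'a)"
  by (simp add: linear_scaleC linear_conv_bounded_linear[symmetric])

lemma levi_form_scaleR:
  fixes u :: "'a::{complex_vector,euclidean_space} \<Rightarrow> real"
  assumes "C_inf_on U u" "x \<in> U"
  shows "levi_form u x (c *\<^sub>R w) = c\<^sup>2 * levi_form u x w"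
proof -
  have "second_deriv u x (c *\<^sub>R v) = c\<^sup>2 * second_deriv u x v" for v
    unfolding second_deriv_expand[OF assms]
    by (simp add: sum_distrib_left power2_eq_square mult_ac)
  then show ?thesis
    by (simp add: levi_form_second_deriv linear_scale[OF linear_scaleC] field_simps)
qed

lemma continuous_on_levi_form:
  fixes u :: "'a::{complex_vector,euclidean_space} \<Rightarrow> real"
  assumes "C_inf_on U u"
  shows "continuous_on (U \<times> UNIV) (\<lambda>(x, w). levi_form u x w)"
proof -
  have c: "continuous_on (U \<times> UNIV) (\<lambda>p. f (fst p))" if "continuous_on U f"
    for f :: "'a \<Rightarrow> real"
    using that by (auto intro!: continuous_on_compose2[of U f] continuous_intros)
  have l: "continuous_on (U \<times> UNIV) (\<lambda>p::'a \<times> 'a. scaleC \<i> (snd p))"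
    using bounded_linear_scaleC
    by (intro bounded_linear.continuous_on[of "scaleC \<i>"] continuous_intros)
  have "continuous_on (U \<times> UNIV) (\<lambda>p. second_deriv u (fst p) (g (snd p)))"
    if "continuous_on (U \<times> UNIV) (\<lambda>p::'a \<times> 'a. g (snd p))" for g
  proof -
    have "continuous_on (U \<times> UNIV) (\<lambda>p. \<Sum>i\<in>Basis. \<Sum>j\<in>Basis.
      (g (snd p) \<bullet> i) * (g (snd p) \<bullet> j) *
        frechet_derivative (\<lambda>y. frechet_derivative u (at y) i) (at (fst p)) j)"
      using assms that by (intro continuous_intros c[OF C_inf_on_imp_continuous_on]
          C_inf_on_frechet_derivative)
    then show ?thesis
      by (rule continuous_on_cong[THEN iffD2, rotated 2])
        (auto simp: second_deriv_expand[OF assms])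
  qed
  from this[of "\<lambda>x. x", OF continuous_on_snd[OF continuous_on_id]] this[OF l]
  have "continuous_on (U \<times> UNIV) (\<lambda>p. levi_form u (fst p) (snd p))"
    unfolding levi_form_second_deriv by (intro continuous_intros) auto
  then show ?thesis by (simp add: case_prod_unfold)
qed

lemma compact_perturbation_pos:
  fixes q w1 w2 :: "'a::metric_space \<Rightarrow> real"
  assumes "compact K" "continuous_on K q" "continuous_on K w1" "continuous_on K w2"
    and "\<And>x. x \<in> K \<Longrightarrow> q x \<ge> 0" "\<And>x. x \<in> K \<Longrightarrow> q x = 0 \<Longrightarrow> w1 x > 0"
  obtains e0 where "e0 > 0" "\<And>e x. 0 < e \<Longrightarrow> e < e0 \<Longrightarrow> x \<in> K \<Longrightarrow> q x + e * w1 x + e\<^sup>2 * w2 x > 0"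
proof -
  have "\<exists>e0>0. \<forall>e x. 0 < e \<longrightarrow> e < e0 \<longrightarrow> x \<in> K \<longrightarrow> q x + e * w1 x + e\<^sup>2 * w2 x > 0"
  proof (rule ccontr)
    assume neg: "\<not> ?thesis"
    have "\<exists>e x. 0 < e \<and> e < inverse (real (Suc n)) \<and> x \<in> K \<and> q x + e * w1 x + e\<^sup>2 * w2 x \<le> 0" for n
      using neg[unfolded not_ex, rule_format, of "inverse (real (Suc n))"] by (auto simp: not_less)
    then obtain e x where ex: "\<And>n. 0 < e n" "\<And>n. e n < inverse (real (Suc n))" "\<And>n. x n \<in> K"
      "\<And>n. q (x n) + e n * w1 (x n) + (e n)\<^sup>2 * w2 (x n) \<le> 0"
      by metis
    obtain l r where l: "l \<in> K" "strict_mono r" "(x \<circ> r) \<longlonglongrightarrow> l"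
      using \<open>compact K\<close> ex(3) unfolding compact_def by metis
    have "e \<longlonglongrightarrow> 0"
      by (rule tendsto_sandwich[OF _ _ tendsto_const LIMSEQ_inverse_real_of_nat])
        (auto intro!: always_eventually less_imp_le ex(1) ex(2)[simplified])
    then have e: "(\<lambda>n. e (r n)) \<longlonglongrightarrow> 0"
      using LIMSEQ_subseq_LIMSEQ[OF _ l(2)] by (auto simp: comp_def)
    have lim: "(\<lambda>n. f (x (r n))) \<longlonglongrightarrow> f l" if "continuous_on K f" for f :: "'a \<Rightarrow> real"
      using continuous_on_tendsto_compose[OF that l(3) l(1)] ex(3) by (simp add: comp_def)
    have "(\<lambda>n. q (x (r n)) + e (r n) * w1 (x (r n)) + (e (r n))\<^sup>2 * w2 (x (r n))) \<longlonglongrightarrow>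
        q l + 0 * w1 l + 0\<^sup>2 * w2 l"
      by (intro tendsto_intros e lim assms)
    then have "q l + 0 * w1 l + 0\<^sup>2 * w2 l \<le> 0"
      by (rule LIMSEQ_le_const2) (use ex(4) in auto)
    then have "q l = 0" using assms(5)[OF l(1)] by simp
    have "w1 (x n) + e n * w2 (x n) \<le> 0" for n
    proof -
      have "e n * (w1 (x n) + e n * w2 (x n)) \<le> 0"
        using ex(4)[of n] assms(5)[OF ex(3)[of n]] by (simp add: power2_eq_square algebra_simps)
      then show ?thesis using ex(1)[of n] by (simp add: mult_le_0_iff)
    qed
    moreover have "(\<lambda>n. w1 (x (r n)) + e (r n) * w2 (x (r n))) \<longlonglongrightarrow> w1 l + 0 * w2 l"
      by (intro tendsto_intros e lim assms)
    ultimately have "w1 l + 0 * w2 l \<le> 0"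
      by (intro LIMSEQ_le_const2) auto
    then show False using assms(6)[OF l(1) \<open>q l = 0\<close>] by simp
  qed
  then show thesis using that by blast
qed

lemma scaleC_vec_nth [simp]: "scaleC c x $ i = c * x $ i" for x :: "complex ^ 'n"
  by (simp add: scaleC_vec_def scaleC_complex_def)

lemma norm_scaleC_vec: "norm (scaleC c x) = cmod c * norm x" for x :: "complex ^ 'n"
  by (simp add: norm_vec_def norm_mult L2_set_right_distrib)

lemma inner_scaleC_ii: "x \<bullet> scaleC \<i> x = 0" for x :: "complex ^ 'n"
  by (simp add: inner_vec_def inner_complex_def)

lemma hermitian_Cauchy_Schwarz:
  fixes s \<sigma> :: "complex ^ 'n"
  shows "(s \<bullet> \<sigma>)\<^sup>2 + (s \<bullet> scaleC \<i> \<sigma>)\<^sup>2 \<le> (norm s)\<^sup>2 * (norm \<sigma>)\<^sup>2"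
proof -
  define A B where "A = s \<bullet> \<sigma>" and "B = s \<bullet> scaleC \<i> \<sigma>"
  let ?v = "A *\<^sub>R \<sigma> + B *\<^sub>R scaleC \<i> \<sigma>"
  have "?v \<bullet> ?v = A * A * (\<sigma> \<bullet> \<sigma>) + 2 * A * B * (\<sigma> \<bullet> scaleC \<i> \<sigma>) +
      B * B * (scaleC \<i> \<sigma> \<bullet> scaleC \<i> \<sigma>)"
    by (simp add: inner_simps inner_commute[of "scaleC \<i> \<sigma>" \<sigma>] algebra_simps)
  then have "(norm ?v)\<^sup>2 = (A\<^sup>2 + B\<^sup>2) * (norm \<sigma>)\<^sup>2"
    by (simp add: inner_scaleC_ii dot_square_norm norm_scaleC_vec power2_eq_square[of A]
        power2_eq_square[of B] distrib_right)
  moreover have "A\<^sup>2 + B\<^sup>2 = s \<bullet> ?v"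
    by (simp add: A_def B_def inner_simps power2_eq_square)
  then have "(A\<^sup>2 + B\<^sup>2)\<^sup>2 \<le> (norm s)\<^sup>2 * (norm ?v)\<^sup>2"
    using Cauchy_Schwarz_ineq[of s ?v] by (simp add: dot_square_norm)
  ultimately have "(A\<^sup>2 + B\<^sup>2) * (A\<^sup>2 + B\<^sup>2) \<le> (A\<^sup>2 + B\<^sup>2) * ((norm s)\<^sup>2 * (norm \<sigma>)\<^sup>2)"
    by (simp add: power2_eq_square mult_ac)
  moreover have "A\<^sup>2 + B\<^sup>2 \<ge> 0" by simp
  ultimately show ?thesis unfolding A_def[symmetric] B_def[symmetric]
    by (cases "A\<^sup>2 + B\<^sup>2 = 0") (auto simp: mult_le_cancel_left)
qed

lemma hermitian_product_bound:
  fixes s \<sigma> :: "complex ^ 'm" and b \<beta> :: "complex ^ 'n"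
  shows "\<bar>(s \<bullet> \<sigma>) * (b \<bullet> \<beta>) + (s \<bullet> scaleC \<i> \<sigma>) * (b \<bullet> scaleC \<i> \<beta>)\<bar>
    \<le> norm s * norm \<sigma> * norm b * norm \<beta>"
proof (rule abs_le_square_iff[THEN iffD2, of _ "norm s * norm \<sigma> * norm b * norm \<beta>", simplified abs_mult abs_norm_cancel])
  define A B C D where d: "A = s \<bullet> \<sigma>" "B = s \<bullet> scaleC \<i> \<sigma>" "C = b \<bullet> \<beta>" "D = b \<bullet> scaleC \<i> \<beta>"
  have "(A * C + B * D)\<^sup>2 + (A * D - B * C)\<^sup>2 = (A\<^sup>2 + B\<^sup>2) * (C\<^sup>2 + D\<^sup>2)"
    by (simp add: power2_eq_square algebra_simps)
  then have "(A * C + B * D)\<^sup>2 \<le> (A\<^sup>2 + B\<^sup>2) * (C\<^sup>2 + D\<^sup>2)"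
    using zero_le_power2[of "A * D - B * C"] by linarith
  also have "\<dots> \<le> ((norm s)\<^sup>2 * (norm \<sigma>)\<^sup>2) * ((norm b)\<^sup>2 * (norm \<beta>)\<^sup>2)"
    unfolding d by (intro mult_mono hermitian_Cauchy_Schwarz) auto
  finally show "(A * C + B * D)\<^sup>2 \<le> (norm s * norm \<sigma> * norm b * norm \<beta>)\<^sup>2"
    by (simp add: power_mult_distrib mult_ac)
qed

subsection \<open>Hyperplanes and functionals\<close>

lemma clinear_iff:
  "clinear f \<longleftrightarrow> (\<forall>u v. f (u + v) = f u + f v) \<and> (\<forall>c v. f (scaleC c v) = scaleC c (f v))"
  by (simp add: Vector_Spaces.linear_iff complex_vector.vector_space_axioms)

lemma clinear_add: "clinear f \<Longrightarrow> f (u + v) = f u + f v"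
  and clinear_scaleC: "clinear f \<Longrightarrow> f (scaleC c v) = scaleC c (f v)"
  by (simp_all add: clinear_iff)

lemma clinear_zero: "clinear f \<Longrightarrow> f 0 = 0"
  using clinear_scaleC[of f 0 0] by (simp add: complex_vector.scale_zero_left)

lemma clinear_sum: "clinear f \<Longrightarrow> f (\<Sum>i\<in>A. g i) = (\<Sum>i\<in>A. f (g i))"
  by (induction A rule: infinite_finite_induct) (simp_all add: clinear_zero clinear_add)

lemma clinear_diff: "clinear f \<Longrightarrow> f (u - v) = f u - f v"
  using clinear_add[of f "u - v" v] by simp

lemma clinear_imp_linear: "clinear f \<Longrightarrow> linear f"
  by (rule linearI) (simp_all add: clinear_iff scaleR_scaleC)

lemma clinear_compose: "clinear f \<Longrightarrow> clinear g \<Longrightarrow> clinear (f \<circ> g)"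
  by (simp add: clinear_iff)

lemma clinear_iso_compose: "clinear_iso f \<Longrightarrow> clinear_iso g \<Longrightarrow> clinear_iso (f \<circ> g)"
  by (simp add: clinear_iso_def clinear_compose bij_comp del: comp_apply)

lemma clinear_iso_inv:
  assumes "clinear_iso f"
  shows "clinear_iso (inv f)"
proof -
  have f: "clinear f" "bij f" using assms by (auto simp: clinear_iso_def)
  have "inv f (u + v) = inv f u + inv f v" "inv f (scaleC c v) = scaleC c (inv f v)" for u v c
    using f by (auto intro!: inv_f_eq bij_is_inj simp: clinear_iff bij_is_surj surj_f_inv_f)
  then show ?thesis using f(2) by (simp add: clinear_iso_def clinear_iff bij_imp_bij_inv)
qed

lemma clinear_iso_id: "clinear_iso id"
  by (simp add: clinear_iso_def clinear_iff)

lemma functional_clinear: "clinear y \<Longrightarrow> clinear (functional y a)"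
  by (auto simp: clinear_iff functional_def sum.distrib sum_distrib_left algebra_simps
      scaleC_complex_def)

lemma functional_scale: "functional y (scaleC c a) v = c * functional y a v"
  by (simp add: functional_def sum_distrib_left mult.assoc)

lemma functional_basis:
  assumes "clinear_iso y"
  shows "functional y a (inv y (axis i 1)) = a $ i"
proof -
  have "y (inv y (axis i 1)) = axis i 1"
    using assms by (simp add: clinear_iso_def bij_is_surj surj_f_inv_f)
  then show ?thesis
    by (simp add: functional_def axis_def if_distrib[of "\<lambda>x. _ * x"] cong: if_cong)
qed

lemma functional_of_clinear:
  assumes "clinear_iso y" "clinear f"
  shows "f v = functional y (\<chi> i. f (inv y (axis i 1))) v"
proof -
  have y: "clinear y" "bij y" using assms by (auto simp: clinear_iso_def)
  have yi: "y (inv y w) = w" for w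
    using y(2) by (simp add: bij_is_surj surj_f_inv_f)
  have "y (\<Sum>i\<in>UNIV. scaleC (y v $ i) (inv y (axis i 1))) = y v"
    by (simp add: clinear_sum[OF y(1)] clinear_scaleC[OF y(1)] yi)
      (simp add: vec_eq_iff axis_def if_distrib[of "\<lambda>x. _ * x"] cong: if_cong)
  then have "v = (\<Sum>i\<in>UNIV. scaleC (y v $ i) (inv y (axis i 1)))"
    using y(2) by (metis bij_pointE)
  then have "f v = f (\<Sum>i\<in>UNIV. scaleC (y v $ i) (inv y (axis i 1)))" by simp
  also have "\<dots> = functional y (\<chi> i. f (inv y (axis i 1))) v"
    by (simp add: clinear_sum[OF assms(2)] clinear_scaleC[OF assms(2)] functional_def
        scaleC_complex_def mult.commute)
  finally show ?thesis .
qed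

lemma functional_eq_zero_iff:
  assumes "clinear_iso y"
  shows "(\<forall>v. functional y a v = 0) \<longleftrightarrow> a = 0"
proof
  assume "\<forall>v. functional y a v = 0"
  then show "a = 0"
    by (metis functional_basis[OF assms] vec_eq_iff zero_index)
qed (simp add: functional_def)

lemma functional_one:
  assumes "clinear_iso y" "a \<noteq> 0"
  obtains v where "functional y a v = 1"
proof -
  obtain w where w: "functional y a w \<noteq> 0" using functional_eq_zero_iff assms by blast
  have "clinear (functional y a)" using assms by (auto simp: clinear_iso_def intro: functional_clinear)
  then have "functional y a (scaleC (1 / functional y a w) w) = 1"
    using w by (simp add: clinear_iff scaleC_complex_def)
  then show thesis by (rule that)
qed

lemma same_kernel_imp_proportional:
  assumes "clinear_iso y" "a \<noteq> 0" "b \<noteq> 0"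
    and "{v. functional y a v = 0} = {v. functional y b v = 0}"
  obtains c where "c \<noteq> 0" "b = scaleC c a"
proof -
  have l: "clinear (functional y d)" for d
    using assms by (auto simp: clinear_iso_def intro: functional_clinear)
  obtain e where e: "functional y a e = 1" using functional_one assms by blast
  let ?c = "functional y b e"
  have *: "functional y b v = ?c * functional y a v" for v
  proof -
    have "functional y a (v - scaleC (functional y a v) e) = 0"
      by (simp add: clinear_diff[OF l] clinear_scaleC[OF l] e scaleC_complex_def)
    then have "functional y b (v - scaleC (functional y a v) e) = 0"
      using assms(4) by blast
    then show ?thesis
      by (simp add: clinear_diff[OF l] clinear_scaleC[OF l] scaleC_complex_def mult.commute)
  qed
  have "b $ i = ?c * a $ i" for i
    using *[of "inv y (axis i 1)"] unfolding functional_basis[OF assms(1)] .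
  then have "b = scaleC ?c a" by (simp add: vec_eq_iff)
  moreover from this have "?c \<noteq> 0"
    using assms(3) by (metis complex_vector.scale_zero_left)
  ultimately show thesis using that by blast
qed

lemma kernel_hyperplane:
  fixes f :: "'v::complex_vector \<Rightarrow> complex"
  assumes "complex_vector.dim (UNIV :: 'v set) \<noteq> 0" "clinear f" "f e = 1"
  shows "{v. f v = 0} \<in> hyperplanes"
proof -
  let ?P = "{v. f v = 0}"
  have P: "complex_vector.subspace ?P"
    unfolding complex_vector.subspace_def
    by (simp add: clinear_zero[OF assms(2)] clinear_add[OF assms(2)] clinear_scaleC[OF assms(2)]
        scaleC_complex_def)
  obtain C where C: "C \<subseteq> ?P" "complex_vector.independent C" "?P \<subseteq> complex_vector.span C"
    "card C = complex_vector.dim ?P"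
    using complex_vector.basis_exists by blast
  have "complex_vector.span C \<subseteq> ?P"
    using C(1) P by (rule complex_vector.span_minimal)
  then have e: "e \<notin> complex_vector.span C" using assms(3) by auto
  have "x \<in> complex_vector.span (insert e C)" for x
  proof -
    have "x - scaleC (f x) e \<in> ?P"
      by (simp add: clinear_diff[OF assms(2)] clinear_scaleC[OF assms(2)] assms(3)
          scaleC_complex_def)
    then show ?thesis
      unfolding complex_vector.span_breakdown_eq using C(3) by blast
  qed
  then have "UNIV \<subseteq> complex_vector.span (insert e C)" by blast
  from complex_vector.basis_card_eq_dim[OF subset_UNIV this
      complex_vector.independent_insertI[OF e C(2)]]
  have card: "card (insert e C) = complex_vector.dim (UNIV :: 'v set)" .
  then have "finite (insert e C)" using assms(1) by (metis card.infinite)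
  moreover have "e \<notin> C" using e complex_vector.span_base by blast
  ultimately show ?thesis using card C(4) P by (simp add: hyperplanes_def)
qed

lemma hyperplane_is_kernel:
  fixes P :: "'v::complex_vector set"
  assumes "complex_vector.dim (UNIV :: 'v set) \<noteq> 0" "P \<in> hyperplanes"
  obtains f e where "clinear f" "f e = (1::complex)" "P = {v. f v = 0}"
proof -
  have P: "complex_vector.subspace P"
    and dim: "complex_vector.dim P + 1 = complex_vector.dim (UNIV :: 'v set)"
    using assms(2) by (auto simp: hyperplanes_def)
  obtain D :: "'v set" where D: "UNIV \<subseteq> complex_vector.span D"
    "card D = complex_vector.dim (UNIV :: 'v set)"
    using complex_vector.basis_exists by blast
  then have "finite D" using assms(1) card_ge_0_finite by force
  have fin: "finite A" if "complex_vector.independent A" for A :: "'v set"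
    using complex_vector.independent_span_bound[OF \<open>finite D\<close> that] D(1) by auto
  obtain C where C: "C \<subseteq> P" "complex_vector.independent C" "P \<subseteq> complex_vector.span C"
    "card C = complex_vector.dim P"
    using complex_vector.basis_exists by blast
  have span: "complex_vector.span C = P"
    using complex_vector.span_minimal[OF C(1) P] C(3) by auto
  obtain e where e: "e \<notin> P" using dim by (cases "P = UNIV") auto
  obtain B where B: "insert e C \<subseteq> B" "complex_vector.independent B" "UNIV \<subseteq> complex_vector.span B"
    using complex_vector.maximal_independent_subset_extend[of "insert e C" UNIV]
      complex_vector.independent_insertI[of e C] e C(2) span by auto
  have "e \<notin> C" using C(1) e by blast
  then have "card B = card (insert e C)"
    using complex_vector.basis_card_eq_dim[OF subset_UNIV B(3,2)] fin[OF C(2)] C(4) dim by simp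
  then have "insert e C = B" using B(1) fin[OF B(2)] by (simp add: card_subset_eq)
  then have "\<exists>k. x - scaleC k e \<in> P" for x
    using B(3) complex_vector.span_breakdown_eq[of x e C] by (auto simp: span)
  then obtain f where f: "\<And>x. x - scaleC (f x) e \<in> P" by metis
  have uniq: "k = f x" if "x - scaleC k e \<in> P" for k x
  proof (rule ccontr)
    assume "k \<noteq> f x"
    have "scaleC (1 / (k - f x)) ((x - scaleC (f x) e) - (x - scaleC k e)) \<in> P"
      by (rule complex_vector.subspace_scale[OF P complex_vector.subspace_diff[OF P f that]])
    moreover have "(x - scaleC (f x) e) - (x - scaleC k e) = scaleC (k - f x) e"
      by (simp add: complex_vector.scale_left_diff_distrib)
    ultimately show False using e \<open>k \<noteq> f x\<close> by (simp add: scaleC_scaleC scaleC_one)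
  qed
  have "f (u + v) = f u + f v" for u v
    using complex_vector.subspace_add[OF P f[of u] f[of v]]
    by (intro uniq[symmetric]) (simp add: scaleC_add_left algebra_simps)
  moreover have "f (scaleC c v) = c * f v" for c v
    using complex_vector.subspace_scale[OF P f[of v], of c]
    by (intro uniq[symmetric]) (simp add: complex_vector.scale_right_diff_distrib scaleC_scaleC)
  ultimately have "clinear f" by (simp add: clinear_iff scaleC_complex_def)
  moreover have "f e = 1"
    using uniq[of e 1] P by (simp add: scaleC_one complex_vector.subspace_0)
  moreover have "P = {v. f v = 0}"
  proof safe
    fix v assume "v \<in> P"
    then show "f v = 0" using uniq[of v 0] by (simp add: complex_vector.scale_zero_left)
  next
    fix v assume "f v = 0"
    then show "v \<in> P" using f[of v] by (simp add: complex_vector.scale_zero_left)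
  qed
  ultimately show thesis by (rule that)
qed

lemma hyperplane_iff:
  fixes y :: "'v::complex_vector \<Rightarrow> complex ^ 'r"
  assumes "complex_vector.dim (UNIV :: 'v set) \<noteq> 0" "clinear_iso y"
  shows "P \<in> hyperplanes \<longleftrightarrow> (\<exists>a. a \<noteq> 0 \<and> P = {v. functional y a v = 0})"
proof
  assume "P \<in> hyperplanes"
  then obtain f e where f: "clinear f" "f e = (1::complex)" "P = {v. f v = 0}"
    by (rule hyperplane_is_kernel[OF assms(1)])
  let ?a = "\<chi> i. f (inv y (axis i 1))"
  have fa: "functional y ?a v = f v" for v
    by (rule functional_of_clinear[OF assms(2) f(1), symmetric])
  then have "?a \<noteq> 0" 
    using functional_eq_zero_iff[OF assms(2), of ?a] f(2) zero_neq_one by metis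
  moreover have "P = {v. functional y ?a v = 0}" unfolding fa by (rule f(3))
  ultimately show "\<exists>a. a \<noteq> 0 \<and> P = {v. functional y a v = 0}" by blast
next
  assume "\<exists>a. a \<noteq> 0 \<and> P = {v. functional y a v = 0}"
  then obtain a where a: "a \<noteq> 0" "P = {v. functional y a v = 0}" by blast
  obtain e where "functional y a e = 1" using functional_one[OF assms(2) a(1)] .
  then show "P \<in> hyperplanes"
    unfolding a(2) using assms
    by (intro kernel_hyperplane functional_clinear) (simp_all add: clinear_iso_def)
qed

lemma clinear_iso_exists:
  assumes "complex_vector.dim (UNIV :: 'v::complex_vector set) = CARD('r::finite)"
  obtains \<psi> :: "complex ^ ('r::finite) \<Rightarrow> 'v::complex_vector" where "clinear_iso \<psi>"
proof -
  obtain B :: "'v set" where B: "complex_vector.independent B" "UNIV \<subseteq> complex_vector.span B"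
    "card B = CARD('r)"
    using complex_vector.basis_exists[of "UNIV :: 'v set"] assms by metis
  then have "finite B" by (metis card_ge_0_finite zero_less_card_finite)
  then obtain b where b: "bij_betw b (UNIV :: 'r set) B"
    using B(3) finite_same_card_bij[of "UNIV :: 'r set" B] by auto
  define \<psi> :: "complex ^ 'r \<Rightarrow> 'v" where "\<psi> z = (\<Sum>i\<in>UNIV. scaleC (z $ i) (b i))" for z
  have \<psi>: "clinear \<psi>"
    by (simp add: clinear_iff \<psi>_def scaleC_add_left sum.distrib complex_vector.scale_sum_right
        scaleC_scaleC)
  have sum_B: "(\<Sum>v\<in>B. scaleC (u v) v) = \<psi> (\<chi> i. u (b i))" for u
    unfolding \<psi>_def using sum.reindex_bij_betw[OF b, of "\<lambda>v. scaleC (u v) v"] by simp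
  have "inj \<psi>"
  proof (rule injI)
    fix z w assume "\<psi> z = \<psi> w"
    then have 0: "\<psi> (z - w) = 0" using clinear_diff[OF \<psi>] by simp
    let ?u = "\<lambda>v. (z - w) $ (inv_into UNIV b v)"
    have bi: "inv_into UNIV b (b i) = i" for i
      using b by (simp add: bij_betw_def)
    have "(\<Sum>v\<in>B. scaleC (?u v) v) = 0"
      unfolding sum_B bi vec_lambda_eta by (rule 0)
    then have "?u v = 0" if "v \<in> B" for v
      using complex_vector.independentD[OF B(1) \<open>finite B\<close> order_refl, of ?u v] that by blast
    then have "(z - w) $ i = 0" for i
      using bi[of i] bij_betwE[OF b] by (metis UNIV_I)
    then show "z = w" by (simp add: vec_eq_iff)
  qed
  moreover have "surj \<psi>"
  proof -
    have "v \<in> range \<psi>" for v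
    proof -
      have "v \<in> complex_vector.span B" using B(2) by blast
      then obtain u where "v = (\<Sum>x\<in>B. scaleC (u x) x)"
        using complex_vector.span_finite[OF \<open>finite B\<close>] by auto
      then show ?thesis by (simp add: sum_B)
    qed
    then show ?thesis by blast
  qed
  ultimately show thesis using that[of \<psi>] \<psi> by (simp add: clinear_iso_def bij_def)
qed

subsection \<open>Metrics on O(1) and their duals\<close>

definition dual_norm :: "(complex ^ 'r \<Rightarrow> real) \<Rightarrow> bool" where
  "dual_norm M \<longleftrightarrow> (\<forall>a. a \<noteq> 0 \<longrightarrow> M a > 0) \<and> (\<forall>c a. M (scaleC c a) = (cmod c)\<^sup>2 * M a)"

text \<open>The metric on O(1) whose dual, read in the homogeneous coordinates a of ker (functional y a),
  is M.\<close>

definition metric_of_dual ::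
  "('v::complex_vector \<Rightarrow> complex ^ 'r) \<Rightarrow> (complex ^ 'r \<Rightarrow> real) \<Rightarrow> 'v set \<times> 'v set \<Rightarrow> real" where
  "metric_of_dual y M = (\<lambda>(P, \<xi>).
     let a = SOME a. a \<noteq> 0 \<and> P = {v. functional y a v = 0}
     in (cmod (the_elem (functional y a ` \<xi>)))\<^sup>2 / M a)"

lemma image_coset_kernel:
  assumes "clinear f" "P = {v. f v = 0}"
  shows "f ` coset P v = {f v}"
proof -
  have "v + 0 \<in> coset P v" unfolding coset_def using assms by (intro imageI) (simp add: clinear_zero[OF assms(1)])
  then show ?thesis using assms(2) by (auto simp: coset_def clinear_add[OF assms(1)])
qed

lemma mem_coset_kernel_iff:
  assumes "clinear f" "P = {v. f v = 0}"
  shows "w \<in> coset P v \<longleftrightarrow> f w = f v"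
proof
  assume "f w = f v"
  then have "w - v \<in> P" using assms by (simp add: clinear_diff[OF assms(1)])
  then have "v + (w - v) \<in> coset P v" unfolding coset_def by (rule imageI)
  then show "w \<in> coset P v" by simp
qed (use assms in \<open>auto simp: coset_def clinear_add[OF assms(1)]\<close>)

lemma coset_kernel_eq_iff:
  assumes "clinear f" "P = {v. f v = 0}"
  shows "coset P v = coset P w \<longleftrightarrow> f v = f w"
  using mem_coset_kernel_iff[OF assms] by (metis (no_types) subsetI subset_antisym)

lemma metric_of_dual_eq:
  assumes y: "clinear_iso y" and M: "dual_norm M" and a: "a \<noteq> 0" "P = {v. functional y a v = 0}"
  shows "metric_of_dual y M (P, coset P v) = (cmod (functional y a v))\<^sup>2 / M a"
proof -
  define b where "b = (SOME a. a \<noteq> 0 \<and> P = {v. functional y a v = 0})"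
  have b: "b \<noteq> 0 \<and> P = {v. functional y b v = 0}"
    unfolding b_def by (rule someI[of _ a]) (use a in blast)
  have "clinear (functional y b)" using y by (simp add: clinear_iso_def functional_clinear)
  then have "functional y b ` coset P v = {functional y b v}"
    by (rule image_coset_kernel) (use b in blast)
  then have "metric_of_dual y M (P, coset P v) = (cmod (functional y b v))\<^sup>2 / M b"
    unfolding metric_of_dual_def by (simp add: b_def[symmetric])
  moreover obtain c where c: "c \<noteq> 0" "b = scaleC c a"
    using same_kernel_imp_proportional[OF y a(1)] b a(2) by metis
  have "M b = (cmod c)\<^sup>2 * M a" using M unfolding c dual_norm_def by blast
  ultimately show ?thesis
    unfolding c(2) using c(1) by (simp add: functional_scale norm_mult power_mult_distrib)
qed

context
  fixes y :: "'v::complex_vector \<Rightarrow> complex ^ 'r" and M :: "complex ^ 'r \<Rightarrow> real"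
  assumes dim: "complex_vector.dim (UNIV :: 'v set) \<noteq> 0"
    and y: "clinear_iso y" and M: "dual_norm M"
begin

lemma metric_on_O1_metric_of_dual: "metric_on_O1 (metric_of_dual y M)"
  unfolding metric_on_O1_def hermitian_metric_def
proof
  fix P :: "'v set" assume "P \<in> hyperplanes"
  then obtain a where a: "a \<noteq> 0" "P = {v. functional y a v = 0}"
    using hyperplane_iff[OF dim y] by blast
  let ?f = "functional y a"
  have f: "clinear ?f" using y by (simp add: clinear_iso_def functional_clinear)
  have M0: "M a > 0" using M a(1) by (simp add: dual_norm_def)
  define H where "H \<xi> \<eta> = the_elem (?f ` \<xi>) * cnj (the_elem (?f ` \<eta>)) / complex_of_real (M a)"
    for \<xi> \<eta>
  have H: "H (coset P v) (coset P w) = ?f v * cnj (?f w) / complex_of_real (M a)" for v w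
    by (simp add: H_def image_coset_kernel[OF f a(2)])
  have HH: "Re (H (coset P v) (coset P v)) = (cmod (?f v))\<^sup>2 / M a" for v
    unfolding H complex_norm_square[symmetric] of_real_divide[symmetric] Re_complex_of_real ..
  have "positive_hermitian_form (coset P) H"
    unfolding positive_hermitian_form_def
  proof (intro conjI allI impI)
    fix v assume "coset P v \<noteq> coset P 0"
    then have "?f v \<noteq> 0" using coset_kernel_eq_iff[OF f a(2)] clinear_zero[OF f] by metis
    then show "0 < Re (H (coset P v) (coset P v))" unfolding HH using M0 by simp
  qed (simp_all add: H clinear_add[OF f] clinear_scaleC[OF f] scaleC_complex_def
        algebra_simps add_divide_distrib)
  moreover have "metric_of_dual y M (P, coset P v) = Re (H (coset P v) (coset P v))" for v
    unfolding HH by (rule metric_of_dual_eq[OF y M a])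
  ultimately show "\<exists>H. positive_hermitian_form (coset P) H \<and>
      (\<forall>v. metric_of_dual y M (P, coset P v) = Re (H (coset P v) (coset P v)))"
    by blast
qed

lemma coset_mem_O1: "a \<noteq> 0 \<Longrightarrow> P = {v. functional y a v = 0} \<Longrightarrow> (P, coset P v) \<in> O1"
  unfolding O1_def using hyperplane_iff[OF dim y] by blast

lemma O1_cases:
  assumes "p \<in> O1"
  obtains a v P where "a \<noteq> 0" "P = {v. functional y a v = 0}" "p = (P, coset P v)"
  using assms hyperplane_iff[OF dim y] unfolding O1_def by blast

lemma O1_dual_metric_eq:
  fixes x :: "'v \<Rightarrow> complex ^ 'r"
  assumes x: "clinear_iso x" and k: "\<And>p. p \<in> O1 \<Longrightarrow> k p = metric_of_dual y M p"
    and a: "a \<noteq> 0" and b: "\<And>v. functional x a v = functional y b v"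
  shows "O1_dual_metric k (O1_dual_point x a t) = (cmod t)\<^sup>2 * M b"
proof -
  let ?f = "functional x a"
  define P where "P = {v. ?f v = 0}"
  have b0: "b \<noteq> 0" and Pb: "P = {v. functional y b v = 0}"
    using a functional_eq_zero_iff[OF x, of a] functional_eq_zero_iff[OF y, of b] b
    unfolding P_def by (metis, metis)
  have f: "clinear ?f" using x by (simp add: clinear_iso_def functional_clinear)
  note P = P_def
  have M0: "M b > 0" using M b0 by (simp add: dual_norm_def)
  have eq: "O1_dual_metric k (O1_dual_point x a t) = (SUP \<xi>\<in>range (coset P) - {coset P 0}.
     (cmod ((\<lambda>\<xi>\<in>range (coset P). t * the_elem (?f ` \<xi>)) \<xi>))\<^sup>2 / k (P, \<xi>))"
    unfolding O1_dual_metric_def O1_dual_point_def dual_metric_def Let_def P_def[symmetric] by simp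
  have "(cmod ((\<lambda>\<xi>\<in>range (coset P). t * the_elem (?f ` \<xi>)) \<xi>))\<^sup>2 / k (P, \<xi>) = (cmod t)\<^sup>2 * M b"
    if \<xi>: "\<xi> \<in> range (coset P) - {coset P 0}" for \<xi>
  proof -
    obtain v where v: "\<xi> = coset P v" using \<xi> by auto
    then have "?f v \<noteq> 0"
      using \<xi> coset_kernel_eq_iff[OF f P, of v 0] clinear_zero[OF f] by auto
    moreover have "k (P, \<xi>) = (cmod (?f v))\<^sup>2 / M b"
      unfolding v using k[OF coset_mem_O1[OF b0 Pb]] metric_of_dual_eq[OF y M b0 Pb] b by simp
    ultimately show ?thesis
      unfolding v image_coset_kernel[OF f P] using M0 image_coset_kernel[OF f P]
      by (simp add: norm_mult power_mult_distrib)
  qed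
  moreover have "range (coset P) - {coset P 0} \<noteq> {}"
  proof -
    obtain v where "?f v = 1" using functional_one[OF x a] .
    then have "coset P v \<noteq> coset P 0"
      using coset_kernel_eq_iff[OF f P] clinear_zero[OF f] by simp
    then show ?thesis by blast
  qed
  ultimately show ?thesis
    unfolding eq by (metis (no_types, lifting) SUP_cong cSUP_const)
qed

lemma metric_of_dual_change:
  fixes x :: "'v \<Rightarrow> complex ^ 'r"
  assumes x: "clinear_iso x" and A: "\<And>a v. functional x a v = functional y (A a) v"
    and MA: "dual_norm (\<lambda>a. M (A a))" and p: "p \<in> O1"
  shows "metric_of_dual x (\<lambda>a. M (A a)) p = metric_of_dual y M p"
proof -
  obtain a v P where a: "a \<noteq> 0" "P = {v. functional x a v = 0}" "p = (P, coset P v)"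
    using p hyperplane_iff[OF dim x] unfolding O1_def by blast
  have "A a \<noteq> 0"
    using a(1) functional_eq_zero_iff[OF x, of a] functional_eq_zero_iff[OF y, of "A a"] A by metis
  moreover have "P = {v. functional y (A a) v = 0}" using a(2) A by simp
  ultimately show ?thesis
    unfolding a(3) metric_of_dual_eq[OF x MA a(1,2)] using metric_of_dual_eq[OF y M] A by metis
qed

end

lemma pull_K_metric_of_dual:
  fixes y :: "'v::complex_vector \<Rightarrow> complex ^ 'r" and \<phi> :: "'w::complex_vector \<Rightarrow> 'v"
  assumes dim: "complex_vector.dim (UNIV :: 'v set) \<noteq> 0" "complex_vector.dim (UNIV :: 'w set) \<noteq> 0"
    and y: "clinear_iso y" and M: "dual_norm M" and \<phi>: "clinear_iso \<phi>"
  shows "pull_K \<phi> (restrict (metric_of_dual y M) O1) = restrict (metric_of_dual (y \<circ> \<phi>) M) O1"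
proof
  fix p :: "'w set \<times> 'w set"
  have y\<phi>: "clinear_iso (y \<circ> \<phi>)" using y \<phi> by (rule clinear_iso_compose)
  have fnl: "functional (y \<circ> \<phi>) a w = functional y a (\<phi> w)" for a w
    by (simp add: functional_def)
  show "pull_K \<phi> (restrict (metric_of_dual y M) O1) p = restrict (metric_of_dual (y \<circ> \<phi>) M) O1 p"
  proof (cases "p \<in> O1")
    case True
    then obtain a v P where a: "a \<noteq> 0" "P = {v. functional (y \<circ> \<phi>) a v = 0}" "p = (P, coset P v)"
      by (rule O1_cases[OF dim(2) y\<phi> M])
    have "bij \<phi>" "clinear \<phi>" using \<phi> by (auto simp: clinear_iso_def)
    have P: "\<phi> ` P = {v. functional y a v = 0}"
    proof (intro equalityI subsetI)
      fix v assume v: "v \<in> {v. functional y a v = 0}"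
      obtain w where w: "v = \<phi> w" using \<open>bij \<phi>\<close> by (rule bij_pointE) blast
      have "w \<in> P" using v unfolding a(2) w fnl by simp
      then show "v \<in> \<phi> ` P" unfolding w by (rule imageI)
    next
      fix v assume "v \<in> \<phi> ` P"
      then show "v \<in> {v. functional y a v = 0}" unfolding a(2) fnl by blast
    qed
    have c: "\<phi> ` coset P v = coset (\<phi> ` P) (\<phi> v)"
      unfolding coset_def image_image clinear_add[OF \<open>clinear \<phi>\<close>] ..
    have "pull_K \<phi> (restrict (metric_of_dual y M) O1) p =
        restrict (metric_of_dual y M) O1 (\<phi> ` P, coset (\<phi> ` P) (\<phi> v))"
      using True unfolding pull_K_def a(3) by (simp add: c)
    also have "\<dots> = metric_of_dual y M (\<phi> ` P, coset (\<phi> ` P) (\<phi> v))"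
      using coset_mem_O1[OF dim(1) y M a(1) P] by (rule restrict_apply')
    also have "\<dots> = (cmod (functional (y \<circ> \<phi>) a v))\<^sup>2 / M a"
      unfolding fnl by (rule metric_of_dual_eq[OF y M a(1) P])
    also have "\<dots> = restrict (metric_of_dual (y \<circ> \<phi>) M) O1 p"
      using True unfolding a(3) metric_of_dual_eq[OF y\<phi> M a(1,2), symmetric] by simp
    finally show ?thesis .
  qed (simp add: pull_K_def)
qed

lemma complex_dim_vec: "complex_vector.dim (UNIV :: (complex ^ 'r) set) = CARD('r)"
proof -
  have "(scaleC :: complex \<Rightarrow> complex ^ 'r \<Rightarrow> complex ^ 'r) = (*s)"
    by (intro ext) (simp add: vec_eq_iff)
  then show ?thesis using vec_dim_card[where 'a = complex and 'n = 'r] by simp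
qed

definition coord_change ::
  "('v::complex_vector \<Rightarrow> complex ^ 'r) \<Rightarrow> ('v \<Rightarrow> complex ^ 'r) \<Rightarrow> complex ^ 'r \<Rightarrow> complex ^ 'r" where
  "coord_change x y a = (\<chi> i. functional x a (inv y (axis i 1)))"

lemma functional_coord_change:
  assumes "clinear_iso x" "clinear_iso y"
  shows "functional x a v = functional y (coord_change x y a) v"
  unfolding coord_change_def
  using assms by (intro functional_of_clinear functional_clinear) (simp_all add: clinear_iso_def)

lemma clinear_coord_change: "clinear (coord_change x y)"
  by (auto simp: clinear_iff coord_change_def vec_eq_iff functional_scale)
    (simp add: functional_def distrib_right sum.distrib)

lemma bounded_linear_clinear: "clinear f \<Longrightarrow> bounded_linear f"
  for f :: "'a::{complex_vector,euclidean_space} \<Rightarrow> 'b::{complex_vector,euclidean_space}"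
  by (simp add: clinear_imp_linear linear_conv_bounded_linear[symmetric])

lemma coord_change_nonzero:
  assumes "clinear_iso x" "clinear_iso y" "a \<noteq> 0"
  shows "coord_change x y a \<noteq> 0"
proof
  assume "coord_change x y a = 0"
  then have "functional x a v = 0" for v
    unfolding functional_coord_change[OF assms(1,2), of a v] by (simp add: functional_def)
  then show False using functional_eq_zero_iff[OF assms(1), of a] assms(3) by blast
qed

lemma metric_on_O1_restrict: "metric_on_O1 (restrict k O1) \<longleftrightarrow> metric_on_O1 k"
proof -
  have "restrict k O1 (P, coset P v) = k (P, coset P v)" if "P \<in> hyperplanes" for P and v :: 'a
    using that by (simp add: O1_def)
  then have "hermitian_metric (coset P) (\<lambda>\<xi>. restrict k O1 (P, \<xi>)) \<longleftrightarrow>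
      hermitian_metric (coset P) (\<lambda>\<xi>. k (P, \<xi>))" if "P \<in> hyperplanes" for P
    unfolding hermitian_metric_def using that by (simp only:)
  then show ?thesis unfolding metric_on_O1_def by blast
qed

lemma positively_curved_metric_of_dual:
  fixes y :: "'v::complex_vector \<Rightarrow> complex ^ 'r" and M :: "complex ^ 'r \<Rightarrow> real"
  assumes dim: "complex_vector.dim (UNIV :: 'v set) \<noteq> 0" and y: "clinear_iso y"
    and M: "dual_norm M" and C: "C_inf_on (-{0}) M"
    and levi: "\<And>a w. a \<noteq> 0 \<Longrightarrow> w \<noteq> 0 \<Longrightarrow> levi_form M a w > 0"
  shows "restrict (metric_of_dual y M) O1 \<in> K_metrics TYPE('r)"
proof -
  let ?k = "restrict (metric_of_dual y M) O1"
  have "smooth_on ((-{0}) \<times> UNIV) (\<lambda>(a, t). O1_dual_metric ?k (O1_dual_point x a t)) \<and>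
        strongly_psh_on (-{0}) (\<lambda>a. O1_dual_metric ?k (O1_dual_point x a 1))"
    if x: "clinear_iso x" for x :: "'v \<Rightarrow> complex ^ 'r"
  proof
    let ?A = "coord_change x y"
    note A0 = coord_change_nonzero[OF x y]
    have A: "bounded_linear ?A"
      by (intro bounded_linear_clinear clinear_coord_change)
    have eq: "O1_dual_metric ?k (O1_dual_point x a t) = (cmod t)\<^sup>2 * M (?A a)" if "a \<noteq> 0" for a t
      by (rule O1_dual_metric_eq[OF dim y M x _ that functional_coord_change[OF x y]]) simp
    have op: "open ((-{0::complex ^ 'r}) \<times> (UNIV :: complex set))"
      by (intro open_Times) auto
    have "C_inf_on ((-{0}) \<times> UNIV) (\<lambda>p::(complex ^ 'r) \<times> complex. (norm (snd p))\<^sup>2 * M (?A (fst p)))"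
    proof (rule C_inf_on_mult[OF C_inf_on_norm_square[OF bounded_linear_snd op]
          C_inf_on_linear_compose[OF C op bounded_linear_compose[OF A bounded_linear_fst]]])
      fix p :: "(complex ^ 'r) \<times> complex" assume "p \<in> (-{0}) \<times> UNIV"
      then show "?A (fst p) \<in> -{0}" using A0[of "fst p"] by (simp add: mem_Times_iff)
    qed
    then show "smooth_on ((-{0}) \<times> UNIV) (\<lambda>(a, t). O1_dual_metric ?k (O1_dual_point x a t))"
      by (rule C_inf_on_imp_smooth_on) (simp_all add: eq mem_Times_iff case_prod_unfold subset_iff)
    show "strongly_psh_on (-{0}) (\<lambda>a. O1_dual_metric ?k (O1_dual_point x a 1))"
      unfolding strongly_psh_on_def
    proof (intro ballI allI impI)
      fix a w :: "complex ^ 'r" assume aw: "a \<in> -{0}" "w \<noteq> 0"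
      have "levi_form (\<lambda>a. O1_dual_metric ?k (O1_dual_point x a 1)) a w =
          levi_form (\<lambda>a. M (?A a)) a w"
        by (rule levi_form_cong_open[of "-{0}"]) (use aw in \<open>simp_all add: eq open_Compl\<close>)
      also have "\<dots> = levi_form M (?A a) (?A w)"
        using aw A0[of a]
        by (intro levi_form_linear_compose[OF C A clinear_scaleC[OF clinear_coord_change]]) simp
      finally show "levi_form (\<lambda>a. O1_dual_metric ?k (O1_dual_point x a 1)) a w > 0"
        using levi[OF A0[of a] A0[of w]] aw by simp
    qed
  qed
  then show ?thesis
    using metric_on_O1_metric_of_dual[OF dim y M]
    by (simp add: K_metrics_def positively_curved_O1_def metric_on_O1_restrict)
qed

lemma positively_curved_metric_of_dual_over:
  fixes y :: "'v::complex_vector \<Rightarrow> complex ^ 'r" and N :: "(complex ^ 'm) \<times> (complex ^ 'r) \<Rightarrow> real"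
  assumes dim: "complex_vector.dim (UNIV :: 'v set) \<noteq> 0" and y: "clinear_iso y" and "open U"
    and N: "\<And>s. s \<in> U \<Longrightarrow> dual_norm (\<lambda>a. N (s, a))" and C: "C_inf_on (UNIV \<times> -{0}) N"
    and levi: "\<And>s a w. s \<in> U \<Longrightarrow> a \<noteq> 0 \<Longrightarrow> w \<noteq> 0 \<Longrightarrow> levi_form N (s, a) w > 0"
  shows "positively_curved_O1_over TYPE('r) U (\<lambda>(s, p). metric_of_dual y (\<lambda>a. N (s, a)) p)"
proof -
  let ?k = "\<lambda>s p. metric_of_dual y (\<lambda>a. N (s, a)) p"
  have "smooth_on (U \<times> (-{0}) \<times> UNIV) (\<lambda>(s, a, t). O1_dual_metric (?k s) (O1_dual_point x a t)) \<and>
        strongly_psh_on (U \<times> (-{0})) (\<lambda>(s, a). O1_dual_metric (?k s) (O1_dual_point x a 1))"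
    if x: "clinear_iso x" for x :: "'v \<Rightarrow> complex ^ 'r"
  proof
    let ?A = "coord_change x y"
    note A0 = coord_change_nonzero[OF x y]
    have A: "bounded_linear ?A"
      by (intro bounded_linear_clinear clinear_coord_change)
    have eq: "O1_dual_metric (?k s) (O1_dual_point x a t) = (cmod t)\<^sup>2 * N (s, ?A a)"
      if "s \<in> U" "a \<noteq> 0" for s a t
      by (rule O1_dual_metric_eq[OF dim y N[OF that(1)] x _ that(2) functional_coord_change[OF x y]])
        simp
    let ?L = "\<lambda>p::(complex ^ 'm) \<times> (complex ^ 'r) \<times> complex. (fst p, ?A (fst (snd p)))"
    have L: "bounded_linear ?L"
      by (intro bounded_linear_Pair bounded_linear_fst bounded_linear_compose[OF A]
          bounded_linear_fst_comp bounded_linear_snd)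
    let ?W = "(UNIV :: (complex ^ 'm) set) \<times> (-{0::complex ^ 'r}) \<times> (UNIV :: complex set)"
    have op: "open ?W"
      by (intro open_Times) auto
    have "C_inf_on ?W (\<lambda>p. (norm (snd (snd p)))\<^sup>2 * N (?L p))"
    proof (rule C_inf_on_mult[OF C_inf_on_norm_square[OF bounded_linear_snd_comp op]
          C_inf_on_linear_compose[OF C op L]])
      show "?L p \<in> UNIV \<times> -{0}" if "p \<in> ?W" for p
        using that A0[of "fst (snd p)"] by (simp add: mem_Times_iff)
    qed (rule bounded_linear_snd)
    then show "smooth_on (U \<times> (-{0}) \<times> UNIV)
        (\<lambda>(s, a, t). O1_dual_metric (?k s) (O1_dual_point x a t))"
      by (rule C_inf_on_imp_smooth_on) (simp_all add: eq mem_Times_iff case_prod_unfold subset_iff)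
    let ?K = "\<lambda>p::(complex ^ 'm) \<times> (complex ^ 'r). (fst p, ?A (snd p))"
    have K: "bounded_linear ?K"
      by (intro bounded_linear_Pair bounded_linear_fst bounded_linear_compose[OF A] bounded_linear_snd)
    show "strongly_psh_on (U \<times> (-{0})) (\<lambda>(s, a). O1_dual_metric (?k s) (O1_dual_point x a 1))"
      unfolding strongly_psh_on_def
    proof (intro ballI allI impI)
      fix p w :: "(complex ^ 'm) \<times> (complex ^ 'r)" assume pw: "p \<in> U \<times> -{0}" "w \<noteq> 0"
      have "levi_form (\<lambda>(s, a). O1_dual_metric (?k s) (O1_dual_point x a 1)) p w =
          levi_form (\<lambda>p. N (?K p)) p w"
        by (rule levi_form_cong_open[of "U \<times> -{0}"])
          (use pw \<open>open U\<close> in \<open>simp_all add: eq open_Times open_Compl mem_Times_iff case_prod_unfold\<close>)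
      also have "\<dots> = levi_form N (?K p) (?K w)"
        using pw A0[of "snd p"]
        by (intro levi_form_linear_compose[OF C K])
          (simp_all add: scaleC_prod_def clinear_scaleC[OF clinear_coord_change] mem_Times_iff)
      finally have *: "levi_form (\<lambda>(s, a). O1_dual_metric (?k s) (O1_dual_point x a 1)) p w =
        levi_form N (fst p, ?A (snd p)) (?K w)" .
      have "?K w \<noteq> 0"
        using pw(2) A0[of "snd w"] by (auto simp: prod_eq_iff zero_prod_def)
      then show "levi_form (\<lambda>(s, a). O1_dual_metric (?k s) (O1_dual_point x a 1)) p w > 0"
        unfolding * using pw A0[of "snd p"] by (intro levi) (auto simp: mem_Times_iff)
    qed
  qed
  then show ?thesis
    using metric_on_O1_metric_of_dual[OF dim y N]
    by (simp add: positively_curved_O1_over_def)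
qed

subsection \<open>Diagonal hermitian metrics\<close>

lemma Re_sum_divide_norm_square:
  "Re (\<Sum>i\<in>UNIV. z $ i * cnj (z $ i) / complex_of_real (l i)) = (\<Sum>i\<in>UNIV. (cmod (z $ i))\<^sup>2 / l i)"
  for z :: "complex ^ 'r"
proof -
  have "Re (z $ i * cnj (z $ i) / complex_of_real (l i)) = (cmod (z $ i))\<^sup>2 / l i" for i
    unfolding complex_norm_square[symmetric] of_real_divide[symmetric] Re_complex_of_real ..
  then show ?thesis by (simp only: Re_sum)
qed

lemma hermitian_metric_diagonal:
  fixes y :: "'v::complex_vector \<Rightarrow> complex ^ 'r"
  assumes "clinear_iso y" "\<And>i. l i > 0"
  shows "hermitian_metric id (\<lambda>v. \<Sum>i\<in>UNIV. (cmod (y v $ i))\<^sup>2 / l i)"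
proof -
  define H where "H u v = (\<Sum>i\<in>UNIV. y u $ i * cnj (y v $ i) / complex_of_real (l i))" for u v
  have y: "clinear y" "bij y" using assms(1) by (auto simp: clinear_iso_def)
  have HH: "Re (H v v) = (\<Sum>i\<in>UNIV. (cmod (y v $ i))\<^sup>2 / l i)" for v
    unfolding H_def by (rule Re_sum_divide_norm_square)
  have "positive_hermitian_form id H"
    unfolding positive_hermitian_form_def id_apply
  proof (intro conjI allI impI)
    fix v :: 'v assume "v \<noteq> 0"
    then have "y v \<noteq> 0" using y by (metis bij_pointE clinear_zero)
    then obtain i where "y v $ i \<noteq> 0" by (auto simp: vec_eq_iff)
    then have "0 < (\<Sum>i\<in>UNIV. (cmod (y v $ i))\<^sup>2 / l i)"
      using assms(2) by (intro sum_pos2[of UNIV i]) (auto simp: less_imp_le)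
    then show "0 < Re (H v v)" unfolding HH .
  qed (simp_all add: H_def clinear_add[OF y(1)] clinear_scaleC[OF y(1)] algebra_simps
      add_divide_distrib sum.distrib sum_distrib_left)
  then show ?thesis unfolding hermitian_metric_def using HH by auto
qed

lemma dual_metric_diagonal:
  fixes y :: "'v::complex_vector \<Rightarrow> complex ^ 'r"
  assumes y: "clinear_iso y" and l: "\<And>i. l i > 0" and c: "c > 0"
    and h: "\<And>v. h v = c * (\<Sum>i\<in>UNIV. (cmod (y v $ i))\<^sup>2 / l i)"
  shows "dual_metric id h (functional y (axis j 1)) = l j / c"
proof -
  have yl: "clinear y" "bij y" using y by (auto simp: clinear_iso_def)
  have f: "functional y (axis j 1) v = y v $ j" for v
    by (simp add: functional_def axis_def if_distrib[of "\<lambda>x. x * _"] cong: if_cong)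
  let ?v = "inv y (axis j 1)"
  have yv: "y ?v = axis j 1" using yl(2) by (simp add: bij_is_surj surj_f_inv_f)
  have "h ?v = c / l j"
    unfolding h yv by (simp add: axis_def if_distrib[of "\<lambda>x. (cmod x)\<^sup>2 / _"] cong: if_cong)
  moreover have "?v \<noteq> 0"
    using yv clinear_zero[OF yl(1)] by (metis axis_eq_0_iff zero_neq_one)
  ultimately have "l j / c \<in> (\<lambda>v. (cmod (functional y (axis j 1) v))\<^sup>2 / h v) ` (range id - {id 0})"
    unfolding f by (intro image_eqI[of _ _ ?v]) (simp_all add: yv)
  moreover have "(cmod (functional y (axis j 1) v))\<^sup>2 / h v \<le> l j / c" if "v \<in> range id - {id 0}" for v
  proof -
    have "y v \<noteq> 0" using that yl by (metis DiffE bij_pointE clinear_zero id_apply singletonI)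
    then obtain i where "y v $ i \<noteq> 0" by (auto simp: vec_eq_iff)
    then have "0 < (\<Sum>i\<in>UNIV. (cmod (y v $ i))\<^sup>2 / l i)"
      using l by (intro sum_pos2[of UNIV i]) (auto simp: less_imp_le)
    moreover have "(cmod (y v $ j))\<^sup>2 / l j \<le> (\<Sum>i\<in>UNIV. (cmod (y v $ i))\<^sup>2 / l i)"
      using l by (intro member_le_sum) (auto simp: less_imp_le)
    ultimately show ?thesis
      unfolding f h using l[of j] c by (simp add: field_simps)
  qed
  ultimately show ?thesis
    unfolding dual_metric_def by (intro cSup_eq_maximum) auto
qed

lemma k_of_diagonal:
  fixes y :: "'v::complex_vector \<Rightarrow> complex ^ 'r"
  assumes y: "clinear_iso y" and l: "\<And>i. l i > 0" and a: "a \<noteq> 0" "P = {v. functional y a v = 0}"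
    and h: "\<And>v. h (s, v) = (\<Sum>i\<in>UNIV. (cmod (y v $ i))\<^sup>2 / l i)"
  shows "k_of h (s, P, coset P v) = (cmod (functional y a v))\<^sup>2 / (\<Sum>i\<in>UNIV. l i * (cmod (a $ i))\<^sup>2)"
proof -
  let ?f = "functional y a" and ?N = "\<Sum>i\<in>UNIV. l i * (cmod (a $ i))\<^sup>2"
  have yl: "clinear y" "bij y" using y by (auto simp: clinear_iso_def)
  have f: "clinear ?f" using yl(1) by (rule functional_clinear)
  obtain i where "a $ i \<noteq> 0" using a(1) by (auto simp: vec_eq_iff)
  then have N: "?N > 0" using l by (intro sum_pos2[of UNIV i]) (auto simp: less_imp_le)
  define D where "D = ?N"
  have "D > 0" using N by (simp add: D_def)
  have "(LEAST t. t \<in> (\<lambda>v. h (s, v)) ` coset P v) = (cmod (?f v))\<^sup>2 / ?N"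
  proof (rule Least_equality)
    define z :: "complex ^ 'r" where
      "z = (\<chi> i. ?f v / complex_of_real D * (complex_of_real (l i) * cnj (a $ i)))"
    obtain w where w: "y w = z" using yl(2) by (metis bij_pointE)
    have N': "complex_of_real D \<noteq> 0"
      using \<open>D > 0\<close> by simp
    have cn: "(complex_of_real (cmod c))\<^sup>2 = c * cnj c" for c
      using complex_norm_square[of c] by simp
    have "?f w = (\<Sum>i\<in>UNIV. ?f v / complex_of_real D * complex_of_real (l i * (cmod (a $ i))\<^sup>2))"
      unfolding functional_def[of y a w] w z_def
      by (intro sum.cong refl) (simp add: cn)
    also have "\<dots> = ?f v"
      unfolding sum_distrib_left[symmetric] of_real_sum[symmetric] D_def[symmetric]
      by (rule iffD1[OF nonzero_eq_divide_eq[OF N'] refl])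
    finally have "w \<in> coset P v" using mem_coset_kernel_iff[OF f a(2)] by simp
    moreover have "h (s, w) = (cmod (?f v))\<^sup>2 / ?N"
    proof -
      have "(cmod (z $ i))\<^sup>2 / l i = (cmod (?f v))\<^sup>2 / D\<^sup>2 * (l i * (cmod (a $ i))\<^sup>2)" for i
        using l[of i] \<open>D > 0\<close>
        by (simp add: z_def norm_mult norm_divide power_mult_distrib power_divide power2_eq_square)
      then have "h (s, w) = (cmod (?f v))\<^sup>2 / D\<^sup>2 * D"
        unfolding h w D_def by (simp only: sum_distrib_left)
      then show ?thesis
        using \<open>D > 0\<close> unfolding D_def[symmetric] by (simp add: power2_eq_square)
    qed
    ultimately show "(cmod (?f v))\<^sup>2 / ?N \<in> (\<lambda>v. h (s, v)) ` coset P v" by (metis imageI)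
  next
    fix t assume "t \<in> (\<lambda>v. h (s, v)) ` coset P v"
    then obtain w where w: "w \<in> coset P v" "t = h (s, w)" by blast
    have "cmod (?f w) \<le> (\<Sum>i\<in>UNIV. cmod (a $ i) * cmod (y w $ i))"
      unfolding functional_def by (rule order_trans[OF norm_sum]) (simp add: norm_mult)
    also have "\<dots> = (\<Sum>i\<in>UNIV. (sqrt (l i) * cmod (a $ i)) * (cmod (y w $ i) / sqrt (l i)))"
      using l by (intro sum.cong refl) (simp add: less_imp_neq[OF l, symmetric])
    finally have "(cmod (?f w))\<^sup>2 \<le>
        (\<Sum>i\<in>UNIV. (sqrt (l i) * cmod (a $ i)) * (cmod (y w $ i) / sqrt (l i)))\<^sup>2"
      by (rule power_mono) simp
    also have "\<dots> \<le> (\<Sum>i\<in>UNIV. (sqrt (l i) * cmod (a $ i))\<^sup>2) * (\<Sum>i\<in>UNIV. (cmod (y w $ i) / sqrt (l i))\<^sup>2)"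
      by (rule Cauchy_Schwarz_ineq_sum)
    also have "\<dots> = ?N * h (s, w)"
      unfolding h using l by (simp add: power_mult_distrib power_divide less_imp_le)
    finally show "(cmod (?f v))\<^sup>2 / ?N \<le> t"
      using w N mem_coset_kernel_iff[OF f a(2)] by (simp add: divide_le_eq mult.commute)
  qed
  then show ?thesis by (simp add: k_of_def)
qed

subsection \<open>Equivariance\<close>

lemma equivariant_metric_of_dual:
  fixes M :: "complex ^ 'r \<Rightarrow> real" and \<phi> A :: "complex ^ 'r \<Rightarrow> complex ^ 'r"
  assumes \<Psi>: "GL_equivariant \<Psi>" and M: "dual_norm M" and MA: "dual_norm (\<lambda>a. M (A a))"
    and K: "restrict (metric_of_dual id M) O1 \<in> K_metrics TYPE('r)"
    and \<phi>: "clinear_iso \<phi>" and A: "\<And>a z. functional id (A a) (\<phi> z) = functional id a z"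
  shows "\<Psi> (restrict (metric_of_dual id (\<lambda>a. M (A a))) O1) =
    \<Psi> (restrict (metric_of_dual id M) O1) \<circ> \<phi>"
proof -
  have dim: "complex_vector.dim (UNIV :: (complex ^ 'r) set) \<noteq> 0"
    by (simp add: complex_dim_vec)
  have "pull_K \<phi> (restrict (metric_of_dual id M) O1) = restrict (metric_of_dual (id \<circ> \<phi>) M) O1"
    by (rule pull_K_metric_of_dual[OF dim dim clinear_iso_id M \<phi>])
  also have "\<dots> = restrict (metric_of_dual id (\<lambda>a. M (A a))) O1"
  proof (rule restrict_ext)
    fix p :: "(complex ^ 'r) set \<times> (complex ^ 'r) set" assume "p \<in> O1"
    have "functional id a v = functional (id \<circ> \<phi>) (A a) v" for a v
      using A[of a v] by (simp add: functional_def)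
    from metric_of_dual_change[OF dim _ M clinear_iso_id this MA \<open>p \<in> O1\<close>] \<phi>
    show "metric_of_dual (id \<circ> \<phi>) M p = metric_of_dual id (\<lambda>a. M (A a)) p" by simp
  qed
  finally show ?thesis
    using \<Psi> K \<phi> unfolding GL_equivariant_def pull_H_def by metis
qed

lemma invariant_hermitian_metric:
  fixes H :: "complex ^ 'r \<Rightarrow> real"
  assumes "H \<in> H_metrics"
    and flip: "\<And>i z. H (\<chi> j. if j = i then - z $ j else z $ j) = H z"
    and swap: "\<And>i j z. H (\<chi> l. z $ Transposition.transpose i j l) = H z"
  obtains c where "c > 0" "\<And>z. H z = c * (norm z)\<^sup>2"
proof -
  obtain h where h: "positive_hermitian_form id h" and H: "\<And>z. H z = Re (h z z)"
    using assms(1) by (auto simp: H_metrics_def hermitian_metric_def)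
  have add: "h (u + v) w = h u w + h v w" and scale: "h (scaleC c v) w = c * h v w"
    and herm: "h w v = cnj (h v w)" and pos: "v \<noteq> 0 \<Longrightarrow> Re (h v v) > 0" for u v w c
    using h unfolding positive_hermitian_form_def id_apply by blast+
  have add': "h w (u + v) = h w u + h w v" for u v w
    unfolding herm[of w "u + v"] herm[of w u] herm[of w v] add by simp
  have scale': "h w (scaleC c v) = cnj c * h w v" for c v w
    unfolding herm[of w "scaleC c v"] herm[of w v] scale by simp
  have m1: "scaleC (-1) v = - v" for v :: "complex ^ 'r"
    by (simp add: vec_eq_iff)
  have minus': "h w (- v) = - h w v" and minus: "h (- v) w = - h v w" for v w
    using scale'[of w "-1" v] scale[of "-1" v w] unfolding m1 by simp_all
  have zero: "h 0 w = 0" "h w 0 = 0" for w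
    using scale[of 0 0 w] scale'[of w 0 0] by (simp_all add: complex_vector.scale_zero_left)
  have sum: "h (\<Sum>i\<in>S. f i) w = (\<Sum>i\<in>S. h (f i) w)" for S :: "'r set" and f w
    by (induction S rule: infinite_finite_induct) (simp_all add: add zero)
  have sum': "h w (\<Sum>i\<in>S. f i) = (\<Sum>i\<in>S. h w (f i))" for S :: "'r set" and f w
    by (induction S rule: infinite_finite_induct) (simp_all add: add' zero)
  let ?e = "\<lambda>i. axis i (1::complex) :: complex ^ 'r"
  have polar: "Re (h u v) = 0" if "H (u - v) = H (u + v)" for u v
  proof -
    have "Re (h v u) = Re (h u v)" by (subst herm) simp
    moreover have "h (u - v) (u - v) = h u u - h u v - h v u + h v v"
      using add[of u "- v" "u - v"] add'[of u u "- v"] add'[of v u "- v"]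
      by (simp add: minus minus')
    moreover have "h (u + v) (u + v) = h u u + h u v + h v u + h v v"
      by (simp add: add add')
    ultimately show ?thesis using that unfolding H by simp
  qed
  have orth: "h (?e i) (?e j) = 0" if "i \<noteq> j" for i j
  proof -
    have "Re (h (?e i) (scaleC c (?e j))) = 0" for c
    proof (rule polar)
      have eq: "(\<chi> l. if l = j then - (?e i + scaleC c (?e j)) $ l else (?e i + scaleC c (?e j)) $ l) =
          ?e i - scaleC c (?e j)"
        using that by (auto simp: vec_eq_iff axis_def)
      show "H (?e i - scaleC c (?e j)) = H (?e i + scaleC c (?e j))"
        using flip[of j "?e i + scaleC c (?e j)"] unfolding eq .
    qed
    from this[of 1] this[of \<i>] show ?thesis by (simp add: scale' complex_eq_iff)
  qed
  fix i0 :: 'r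
  have diag: "h (?e i) (?e i) = complex_of_real (H (?e i0))" for i
  proof -
    have eq: "(\<chi> l. ?e i $ Transposition.transpose i i0 l) = ?e i0"
      by (auto simp: vec_eq_iff axis_def Transposition.transpose_def)
    have "H (?e i0) = H (?e i)" using swap[of "?e i" i i0] unfolding eq .
    moreover have "Im (h (?e i) (?e i)) = 0"
      using arg_cong[OF herm[of "?e i" "?e i"], of Im] by simp
    ultimately show ?thesis by (simp add: H complex_eq_iff)
  qed
  have "H z = H (?e i0) * (norm z)\<^sup>2" for z
  proof -
    have z: "z = (\<Sum>i\<in>UNIV. scaleC (z $ i) (?e i))"
      by (simp add: vec_eq_iff axis_def if_distrib[of "\<lambda>x. _ * x"] cong: if_cong)
    have e1: "h z z = (\<Sum>i\<in>UNIV. z $ i * h (?e i) z)"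
      using arg_cong[OF z, of "\<lambda>u. h u z"] unfolding sum scale .
    have e2: "h w z = (\<Sum>i\<in>UNIV. cnj (z $ i) * h w (?e i))" for w
      using arg_cong[OF z, of "\<lambda>u. h w u"] unfolding sum' scale' .
    have inner: "(\<Sum>j\<in>UNIV. cnj (z $ j) * h (?e i) (?e j)) = cnj (z $ i) * H (?e i0)" for i
    proof -
      have "(\<Sum>j\<in>UNIV. cnj (z $ j) * h (?e i) (?e j)) = (\<Sum>j\<in>UNIV. if j = i then cnj (z $ j) * H (?e i0) else 0)"
        by (intro sum.cong) (auto simp: orth diag)
      then show ?thesis by simp
    qed
    have "h z z = (\<Sum>i\<in>UNIV. z $ i * (\<Sum>j\<in>UNIV. cnj (z $ j) * h (?e i) (?e j)))"
      unfolding e1 by (simp only: e2)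
    also have "\<dots> = (\<Sum>i\<in>UNIV. z $ i * (cnj (z $ i) * complex_of_real (H (?e i0))))"
      by (simp only: inner)
    also have "\<dots> =
        complex_of_real (\<Sum>i\<in>UNIV. (cmod (z $ i))\<^sup>2 * H (?e i0))"
      by (simp only: complex_norm_square of_real_sum of_real_mult mult.assoc)
    finally have "H z = (\<Sum>i\<in>UNIV. (cmod (z $ i))\<^sup>2 * H (?e i0))"
      unfolding H[of z] by (simp only: Re_complex_of_real)
    then show ?thesis
      unfolding sum_distrib_right[symmetric]
      by (simp add: norm_vec_def L2_set_def sum_nonneg mult.commute)
  qed
  moreover have "H (?e i0) > 0" unfolding H by (rule pos) simp
  ultimately show thesis using that by blast
qed

subsection \<open>The building blocks of the example\<close>

lemma norm_square_vec: "(norm z)\<^sup>2 = (\<Sum>i\<in>UNIV. (cmod (z $ i))\<^sup>2)" for z :: "complex ^ 'r"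
  by (simp add: norm_vec_def L2_set_def sum_nonneg)

lemma sum_split_two:
  fixes f :: "'r::finite \<Rightarrow> 'a::comm_monoid_add"
  assumes "i \<noteq> j"
  shows "(\<Sum>l\<in>UNIV. f l) = f i + (f j + (\<Sum>l\<in>-{i, j}. f l))"
proof -
  have "UNIV = insert i (insert j (-{i, j}))" by blast
  then have "sum f UNIV = sum f (insert i (insert j (-{i, j})))" by simp
  then show ?thesis using assms by simp
qed

definition hadamard :: "'r::finite \<Rightarrow> 'r \<Rightarrow> complex ^ 'r \<Rightarrow> complex ^ 'r" where
  "hadamard i j a = (\<chi> l. if l = i then (a $ i + a $ j) / complex_of_real (sqrt 2)
     else if l = j then (a $ i - a $ j) / complex_of_real (sqrt 2) else a $ l)"

definition stretch :: "'r::finite \<Rightarrow> complex ^ 'r \<Rightarrow> complex ^ 'r" where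
  "stretch i a = (\<chi> l. if l = i then a $ l else complex_of_real (sqrt 2) * a $ l)"

definition drop_coord :: "'r::finite \<Rightarrow> complex ^ 'r \<Rightarrow> complex ^ 'r" where
  "drop_coord i a = (\<chi> l. if l = i then 0 else a $ l)"

definition quartic :: "complex ^ 'r::finite \<Rightarrow> real" where
  "quartic a = (\<Sum>i\<in>UNIV. cmod (a $ i) ^ 4) / (norm a)\<^sup>2"

lemma sqrt2_mult: "complex_of_real (sqrt 2) * complex_of_real (sqrt 2) = 2"
  unfolding of_real_mult[symmetric] by simp

lemma clinear_hadamard: "clinear (hadamard i j)"
  by (simp add: clinear_iff hadamard_def vec_eq_iff field_simps)

lemma clinear_stretch: "clinear (stretch i)"
  by (simp add: clinear_iff stretch_def vec_eq_iff field_simps)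

lemma clinear_drop_coord: "clinear (drop_coord i)"
  by (simp add: clinear_iff drop_coord_def vec_eq_iff)

lemma hadamard_hadamard:
  assumes "i \<noteq> j"
  shows "hadamard i j (hadamard i j a) = a"
proof -
  have "(x + y) / complex_of_real (sqrt 2) / complex_of_real (sqrt 2) +
      (x - y) / complex_of_real (sqrt 2) / complex_of_real (sqrt 2) = x"
    "(x + y) / complex_of_real (sqrt 2) / complex_of_real (sqrt 2) -
      (x - y) / complex_of_real (sqrt 2) / complex_of_real (sqrt 2) = y" for x y
    by (simp_all add: divide_divide_eq_left sqrt2_mult field_simps)
  then show ?thesis using assms
    by (simp add: hadamard_def vec_eq_iff add_divide_distrib diff_divide_distrib)
qed

lemma norm_hadamard:
  assumes "i \<noteq> j"
  shows "(norm (hadamard i j a))\<^sup>2 = (norm a)\<^sup>2"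
proof -
  have par: "(cmod (x + y) / sqrt 2)\<^sup>2 + (cmod (x - y) / sqrt 2)\<^sup>2 = (cmod x)\<^sup>2 + (cmod y)\<^sup>2" for x y
    unfolding power_divide cmod_power2 by (simp add: power2_eq_square field_simps)
  show ?thesis
    unfolding norm_square_vec sum_split_two[OF assms]
    using assms par[of "a $ i" "a $ j"] by (simp add: hadamard_def norm_divide)
qed

lemma norm_stretch: "(norm (stretch i a))\<^sup>2 = (norm a)\<^sup>2 + (norm (drop_coord i a))\<^sup>2"
  unfolding norm_square_vec sum.distrib[symmetric]
  by (intro sum.cong) (simp_all add: stretch_def drop_coord_def norm_mult power_mult_distrib)

lemma drop_coord_eq_zero:
  assumes "drop_coord i a = 0"
  shows "a = axis i (a $ i)"
  using assms by (auto simp: drop_coord_def vec_eq_iff axis_def split: if_splits)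

lemma quartic_scaleC: "quartic (scaleC c a) = (cmod c)\<^sup>2 * quartic a"
proof (cases "c = 0")
  case False
  have "(\<Sum>i\<in>UNIV. cmod (scaleC c a $ i) ^ 4) = cmod c ^ 4 * (\<Sum>i\<in>UNIV. cmod (a $ i) ^ 4)"
    by (simp add: norm_mult power_mult_distrib sum_distrib_left)
  then show ?thesis
    using False by (simp add: quartic_def norm_scaleC_vec power_mult_distrib power2_eq_square
        power4_eq_xxxx)
qed (simp add: quartic_def complex_vector.scale_zero_left)

lemma quartic_nonneg: "quartic a \<ge> 0"
  by (simp add: quartic_def sum_nonneg)

lemma norm_axis_square: "(norm (axis i z :: complex ^ 'r))\<^sup>2 = (cmod z)\<^sup>2"
  unfolding norm_square_vec
  by (simp add: axis_def if_distrib[of "\<lambda>x. (cmod x)\<^sup>2"] cong: if_cong)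

lemma quartic_axis: "quartic (axis i z) = (cmod z)\<^sup>2"
proof -
  have "(\<Sum>l\<in>UNIV. cmod (axis i z $ l) ^ 4) = cmod z ^ 4"
    by (simp add: axis_def if_distrib[of "\<lambda>x. cmod x ^ 4"] cong: if_cong)
  then show ?thesis
    unfolding quartic_def norm_axis_square by (simp add: power2_eq_square power4_eq_xxxx)
qed

lemma quartic_hadamard_axis:
  assumes "i \<noteq> j"
  shows "quartic (hadamard i j (axis i z)) = (cmod z)\<^sup>2 / 2"
proof -
  have "(\<Sum>l\<in>UNIV. cmod (hadamard i j (axis i z) $ l) ^ 4) = cmod z ^ 4 / 2"
    unfolding sum_split_two[OF assms] using assms
    by (simp add: hadamard_def axis_def norm_divide power_divide)
      (simp add: power4_eq_xxxx field_simps)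
  then show ?thesis
    unfolding quartic_def norm_hadamard[OF assms] norm_axis_square by (simp add: power2_eq_square power4_eq_xxxx)
qed

lemma C_inf_on_quartic: "C_inf_on (-{0}) quartic"
proof -
  have op: "open (-{0 :: complex ^ 'r})" by auto
  have eq: "quartic = (\<lambda>a :: complex ^ 'r. (\<Sum>i\<in>UNIV. ((norm (a $ i))\<^sup>2)\<^sup>2) / (norm a)\<^sup>2)"
    by (simp add: quartic_def fun_eq_iff)
  show ?thesis
    unfolding eq
    by (intro C_inf_on_divide C_inf_on_sum op C_inf_on_power[of _ "\<lambda>a. (norm (a $ _))\<^sup>2"]
        C_inf_on_norm_square bounded_linear_vec_nth bounded_linear_ident) simp
qed

definition cutoff :: "real \<Rightarrow> real" where
  "cutoff t = flat 0 (3/4 - t) / (flat 0 (3/4 - t) + flat 0 (t - 5/8))"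

lemma flat_zero: "x \<le> 0 \<Longrightarrow> flat n x = 0"
  by (simp add: flat_def)

lemma flat_pos: "x > 0 \<Longrightarrow> flat n x > 0"
  by (simp add: flat_def)

lemma flat_nonneg: "flat n x \<ge> 0"
  by (simp add: flat_def)

lemma cutoff_eq_1: "t \<le> 5/8 \<Longrightarrow> cutoff t = 1"
  using flat_pos[of "3/4 - t" 0] by (simp add: cutoff_def flat_zero)

lemma cutoff_eq_0: "t \<ge> 3/4 \<Longrightarrow> cutoff t = 0"
  by (simp add: cutoff_def flat_zero)

lemma cutoff_denominator: "flat 0 (3/4 - t) + flat 0 (t - 5/8) \<noteq> 0"
proof (cases "t < 3/4")
  case True
  then show ?thesis using flat_pos[of "3/4 - t" 0] flat_nonneg[of 0 "t - 5/8"] by linarith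
next
  case False
  then show ?thesis using flat_pos[of "t - 5/8" 0] flat_nonneg[of 0 "3/4 - t"] by linarith
qed

lemma C_inf_on_cutoff: "C_inf_on U f \<Longrightarrow> C_inf_on U (\<lambda>x. cutoff (f x))"
  unfolding cutoff_def
  by (intro C_inf_on_divide C_inf_on_add C_inf_on_flat C_inf_on_diff C_inf_on_const cutoff_denominator)
    (simp_all add: C_inf_on_def)

lemma flat_2_less_1: "flat 2 x < 1"
proof (cases "x > 0")
  case True
  define y where "y = 1 / x"
  have "y > 0" using True by (simp add: y_def)
  have "1 + y / 2 + (y / 2)\<^sup>2 / 2 \<le> exp (y / 2)"
    using exp_lower_Taylor_quadratic[of "y / 2"] \<open>y > 0\<close> by simp
  moreover have "y < 1 + y / 2 + (y / 2)\<^sup>2 / 2"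
    using zero_le_power2[of "y / 2 - 1"] by (simp add: power2_eq_square field_simps)
  ultimately have "y < exp (y / 2)" by linarith
  then have "y * y < exp (y / 2) * exp (y / 2)"
    using \<open>y > 0\<close> by (intro mult_strict_mono) auto
  then have "y\<^sup>2 < exp y" by (simp add: power2_eq_square flip: exp_add)
  then show ?thesis
    using True by (simp add: flat_def y_def exp_minus field_simps)
qed (simp add: flat_def)

lemma flat_4_3: "x \<le> 1/2 \<Longrightarrow> flat 4 x - 2 * flat 3 x \<ge> 0"
  by (cases "x > 0") (simp_all add: flat_def field_simps power4_eq_xxxx power3_eq_cube)

definition base :: "'r::finite \<Rightarrow> (complex ^ 'm) \<times> (complex ^ 'r) \<Rightarrow> real" where
  "base i p = (1 + flat 0 ((norm (fst p))\<^sup>2 - 1/2)) * (norm (snd p))\<^sup>2 +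
     4 * (norm (fst p))\<^sup>2 * (norm (drop_coord i (snd p)))\<^sup>2"

definition pert1 :: "'r::finite \<Rightarrow> 'r \<Rightarrow> (complex ^ 'm) \<times> (complex ^ 'r) \<Rightarrow> real" where
  "pert1 i j p = cutoff ((norm (fst p))\<^sup>2) *
     ((1 - 4 * (norm (fst p))\<^sup>2) * quartic (hadamard i j (snd p)) +
      4 * (norm (fst p))\<^sup>2 * (quartic (stretch i (snd p)) - (norm (stretch i (snd p)))\<^sup>2 / 4))"

definition pert2 :: "'r::finite \<Rightarrow> (complex ^ 'm) \<times> (complex ^ 'r) \<Rightarrow> real" where
  "pert2 i p = cutoff ((norm (fst p))\<^sup>2) * (norm (fst p))\<^sup>2 * (- 1 * quartic (stretch i (snd p)))"

definition family ::
  "'r::finite \<Rightarrow> 'r \<Rightarrow> real \<Rightarrow> (complex ^ 'm) \<times> (complex ^ 'r) \<Rightarrow> real" where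
  "family i j e p = base i p + e * pert1 i j p + e\<^sup>2 * pert2 i p"

abbreviation punctured :: "((complex ^ 'm) \<times> (complex ^ 'r)) set" where
  "punctured \<equiv> UNIV \<times> -{0}"

lemma open_punctured: "open (punctured :: ((complex ^ 'm) \<times> (complex ^ 'r)) set)"
  by (intro open_Times) auto

lemma C_inf_on_fst: "C_inf_on punctured (\<lambda>p :: (complex ^ 'm) \<times> (complex ^ 'r). (norm (fst p))\<^sup>2)"
  by (rule C_inf_on_norm_square[OF bounded_linear_fst open_punctured])

lemma C_inf_on_quartic_compose:
  assumes "clinear L" "\<And>a. a \<noteq> 0 \<Longrightarrow> L a \<noteq> 0"
  shows "C_inf_on punctured (\<lambda>p :: (complex ^ 'm) \<times> (complex ^ 'r). quartic (L (snd p)))"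
  by (rule C_inf_on_linear_compose[OF C_inf_on_quartic open_punctured
        bounded_linear_compose[OF bounded_linear_clinear[OF assms(1)] bounded_linear_snd]])
    (use assms(2) in \<open>auto simp: mem_Times_iff\<close>)

lemma hadamard_nonzero: "i \<noteq> j \<Longrightarrow> a \<noteq> 0 \<Longrightarrow> hadamard i j a \<noteq> 0"
  using norm_hadamard[of i j a] by auto

lemma stretch_nonzero: "a \<noteq> 0 \<Longrightarrow> stretch i a \<noteq> 0"
proof -
  assume "a \<noteq> 0"
  then have "(norm a)\<^sup>2 + (norm (drop_coord i a))\<^sup>2 \<noteq> 0"
    using sum_power2_eq_zero_iff by auto
  then show ?thesis using norm_stretch[of i a] by auto
qed

lemma C_inf_on_base: "C_inf_on punctured (base i :: (complex ^ 'm) \<times> (complex ^ 'r) \<Rightarrow> real)"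
  unfolding base_def
  by (intro C_inf_on_add C_inf_on_mult C_inf_on_const C_inf_on_flat C_inf_on_diff C_inf_on_fst
      C_inf_on_norm_square bounded_linear_snd open_punctured
      bounded_linear_compose[OF bounded_linear_clinear[OF clinear_drop_coord] bounded_linear_snd])

lemma C_inf_on_pert1:
  "i \<noteq> j \<Longrightarrow> C_inf_on punctured (pert1 i j :: (complex ^ 'm) \<times> (complex ^ 'r) \<Rightarrow> real)"
  unfolding pert1_def
  by (intro C_inf_on_add C_inf_on_mult C_inf_on_const C_inf_on_cutoff C_inf_on_diff C_inf_on_fst
      C_inf_on_divide C_inf_on_norm_square open_punctured C_inf_on_quartic_compose
      clinear_hadamard clinear_stretch hadamard_nonzero stretch_nonzero
      bounded_linear_compose[OF bounded_linear_clinear[OF clinear_stretch] bounded_linear_snd]) auto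

lemma C_inf_on_pert2: "C_inf_on punctured (pert2 i :: (complex ^ 'm) \<times> (complex ^ 'r) \<Rightarrow> real)"
  unfolding pert2_def
  by (intro C_inf_on_mult C_inf_on_const C_inf_on_cutoff C_inf_on_fst
      open_punctured C_inf_on_quartic_compose clinear_stretch stretch_nonzero)

lemma C_inf_on_family:
  "i \<noteq> j \<Longrightarrow> C_inf_on punctured (family i j e :: (complex ^ 'm) \<times> (complex ^ 'r) \<Rightarrow> real)"
  unfolding family_def
  by (intro C_inf_on_add C_inf_on_mult C_inf_on_const C_inf_on_base C_inf_on_pert1 C_inf_on_pert2
      open_punctured)

lemma family_scaleC: "family i j e (s, scaleC c a) = (cmod c)\<^sup>2 * family i j e (s, a)"
  by (simp add: family_def base_def pert1_def pert2_def clinear_scaleC[OF clinear_hadamard]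
      clinear_scaleC[OF clinear_stretch] clinear_scaleC[OF clinear_drop_coord] quartic_scaleC
      norm_scaleC_vec power_mult_distrib algebra_simps)

lemma family_center:
  assumes "i \<noteq> j"
  shows "family i j e (0, a) = (norm (hadamard i j a))\<^sup>2 + e * quartic (hadamard i j a)"
  using norm_hadamard[OF assms]
  by (simp add: family_def base_def pert1_def pert2_def cutoff_eq_1 flat_zero)

lemma family_circle:
  assumes "norm s = 1/2"
  shows "family i j e (s, a) = (1 - e / 4) * ((norm (stretch i a))\<^sup>2 + e * quartic (stretch i a))"
proof -
  have t: "(norm s)\<^sup>2 = 1/4" unfolding assms by (simp add: power2_eq_square)
  show ?thesis
    unfolding family_def base_def pert1_def pert2_def fst_conv snd_conv t
    by (simp add: cutoff_eq_1 flat_zero norm_stretch power2_eq_square[of e] algebra_simps)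
qed

lemma family_outside:
  assumes "(norm s)\<^sup>2 \<ge> 3/4"
  shows "family i j e (s, a) = (\<Sum>l\<in>UNIV. (1 + flat 0 ((norm s)\<^sup>2 - 1/2) +
    (if l = i then 0 else 4 * (norm s)\<^sup>2)) * (cmod (a $ l))\<^sup>2)"
proof -
  have "(\<Sum>l\<in>UNIV. (1 + flat 0 ((norm s)\<^sup>2 - 1/2) +
    (if l = i then 0 else 4 * (norm s)\<^sup>2)) * (cmod (a $ l))\<^sup>2) =
    (\<Sum>l\<in>UNIV. (1 + flat 0 ((norm s)\<^sup>2 - 1/2)) * (cmod (a $ l))\<^sup>2 +
      4 * (norm s)\<^sup>2 * (cmod (drop_coord i a $ l))\<^sup>2)"
    by (intro sum.cong) (simp_all add: drop_coord_def algebra_simps)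
  also have "\<dots> = base i (s, a)"
    by (simp add: base_def norm_square_vec[of a] norm_square_vec[of "drop_coord i a"]
        sum.distrib sum_distrib_left)
  finally show ?thesis
    using cutoff_eq_0[OF assms] by (simp add: family_def pert1_def pert2_def)
qed

subsection \<open>Levi forms of the building blocks\<close>

lemma norm_line: "(norm (x + t *\<^sub>R v))\<^sup>2 = (norm x)\<^sup>2 + 2 * (x \<bullet> v) * t + (norm v)\<^sup>2 * t\<^sup>2"
  unfolding power2_norm_eq_inner
  by (simp add: inner_simps inner_commute[of v x] power2_eq_square algebra_simps)

lemma drop_coord_add: "drop_coord i (a + t *\<^sub>R v) = drop_coord i a + t *\<^sub>R drop_coord i v"
  by (simp add: linear_add[OF clinear_imp_linear[OF clinear_drop_coord]]
      linear_scale[OF clinear_imp_linear[OF clinear_drop_coord]])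

lemma second_deriv_base:
  fixes s \<sigma> :: "complex ^ 'm" and a \<alpha> :: "complex ^ 'r"
  assumes "a \<noteq> 0"
  defines "x \<equiv> (norm s)\<^sup>2 - 1/2"
  shows "second_deriv (base i) (s, a) (\<sigma>, \<alpha>) =
    4 * (flat 4 x - 2 * flat 3 x) * (s \<bullet> \<sigma>)\<^sup>2 * (norm a)\<^sup>2 + 2 * flat 2 x * (norm \<sigma>)\<^sup>2 * (norm a)\<^sup>2 +
    8 * flat 2 x * ((s \<bullet> \<sigma>) * (a \<bullet> \<alpha>)) + 2 * (1 + flat 0 x) * (norm \<alpha>)\<^sup>2 +
    8 * (norm \<sigma>)\<^sup>2 * (norm (drop_coord i a))\<^sup>2 +
    32 * ((s \<bullet> \<sigma>) * (drop_coord i a \<bullet> drop_coord i \<alpha>)) +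
    8 * (norm s)\<^sup>2 * (norm (drop_coord i \<alpha>))\<^sup>2"
proof -
  define q where "q c0 c1 c2 t = c0 + 2 * c1 * t + c2 * t\<^sup>2" for c0 c1 c2 t :: real
  have q': "(q c0 c1 c2 has_real_derivative 2 * c1 + 2 * c2 * t) (at t)" for c0 c1 c2 t
    unfolding q_def by (auto intro!: derivative_eq_intros)
  define n where "n = q ((norm s)\<^sup>2) (s \<bullet> \<sigma>) ((norm \<sigma>)\<^sup>2)"
  define m where "m = q ((norm a)\<^sup>2) (a \<bullet> \<alpha>) ((norm \<alpha>)\<^sup>2)"
  define d where "d = q ((norm (drop_coord i a))\<^sup>2) (drop_coord i a \<bullet> drop_coord i \<alpha>)
    ((norm (drop_coord i \<alpha>))\<^sup>2)"
  define n' m' d' where "n' t = 2 * (s \<bullet> \<sigma>) + 2 * (norm \<sigma>)\<^sup>2 * t"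
    and "m' t = 2 * (a \<bullet> \<alpha>) + 2 * (norm \<alpha>)\<^sup>2 * t"
    and "d' t = 2 * (drop_coord i a \<bullet> drop_coord i \<alpha>) + 2 * (norm (drop_coord i \<alpha>))\<^sup>2 * t" for t
  have D: "(n has_real_derivative n' t) (at t)" "(m has_real_derivative m' t) (at t)"
    "(d has_real_derivative d' t) (at t)" for t
    unfolding n_def m_def d_def n'_def m'_def d'_def by (rule q')+
  have D': "(n' has_real_derivative 2 * (norm \<sigma>)\<^sup>2) (at t)"
    "(m' has_real_derivative 2 * (norm \<alpha>)\<^sup>2) (at t)"
    "(d' has_real_derivative 2 * (norm (drop_coord i \<alpha>))\<^sup>2) (at t)" for t
    unfolding n'_def m'_def d'_def by (auto intro!: derivative_eq_intros)
  have F: "((\<lambda>t. flat k (n t - 1/2)) has_real_derivative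
      (flat (k + 2) (n t - 1/2) - real k * flat (Suc k) (n t - 1/2)) * n' t) (at t)" for k t
    by (rule DERIV_chain2[OF flat_has_derivative]) (auto intro!: derivative_eq_intros D)
  have F0: "((\<lambda>t. flat 0 (n t - 1/2)) has_real_derivative flat 2 (n t - 1/2) * n' t) (at t)" for t
    using F[of 0 t] by (simp only: add_0 of_nat_0 mult_zero_left diff_zero)
  have F2: "((\<lambda>t. flat 2 (n t - 1/2)) has_real_derivative
      (flat 4 (n t - 1/2) - 2 * flat 3 (n t - 1/2)) * n' t) (at t)" for t
    using F[of 2 t] by simp
  define G where "G t = (1 + flat 0 (n t - 1/2)) * m t + 4 * n t * d t" for t
  define G' where "G' t = flat 2 (n t - 1/2) * n' t * m t + (1 + flat 0 (n t - 1/2)) * m' t +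
      4 * (n' t * d t + n t * d' t)" for t
  have G: "(G has_real_derivative G' t) (at t)" for t
    unfolding G_def G'_def
    by (rule derivative_eq_intros F0 D refl)+ (simp add: algebra_simps)
  have n0: "n 0 = (norm s)\<^sup>2" "m 0 = (norm a)\<^sup>2" "d 0 = (norm (drop_coord i a))\<^sup>2"
    "n' 0 = 2 * (s \<bullet> \<sigma>)" "m' 0 = 2 * (a \<bullet> \<alpha>)" "d' 0 = 2 * (drop_coord i a \<bullet> drop_coord i \<alpha>)"
    by (simp_all add: n_def m_def d_def q_def n'_def m'_def d'_def)
  show ?thesis
  proof (rule second_deriv_eqI[OF C_inf_on_base _ zero_less_one _ G])
    show "(s, a) \<in> punctured" using assms by simp
    show "base i ((s, a) + t *\<^sub>R (\<sigma>, \<alpha>)) = G t" for t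
      by (simp add: base_def G_def n_def m_def d_def q_def norm_line drop_coord_add)
    show "(G' has_real_derivative
      4 * (flat 4 x - 2 * flat 3 x) * (s \<bullet> \<sigma>)\<^sup>2 * (norm a)\<^sup>2 + 2 * flat 2 x * (norm \<sigma>)\<^sup>2 * (norm a)\<^sup>2 +
      8 * flat 2 x * ((s \<bullet> \<sigma>) * (a \<bullet> \<alpha>)) + 2 * (1 + flat 0 x) * (norm \<alpha>)\<^sup>2 +
      8 * (norm \<sigma>)\<^sup>2 * (norm (drop_coord i a))\<^sup>2 +
      32 * ((s \<bullet> \<sigma>) * (drop_coord i a \<bullet> drop_coord i \<alpha>)) +
      8 * (norm s)\<^sup>2 * (norm (drop_coord i \<alpha>))\<^sup>2) (at 0)"
      unfolding G'_def
      by (rule derivative_eq_intros F0 F2 D D' refl)+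
        (simp add: n0 x_def power2_eq_square algebra_simps)
  qed
qed

lemma levi_form_base_ge:
  fixes s \<sigma> :: "complex ^ 'm" and a \<alpha> :: "complex ^ 'r"
  assumes "a \<noteq> 0" "norm s \<le> 1"
  defines "f \<equiv> flat 2 ((norm s)\<^sup>2 - 1/2)"
  shows "levi_form (base i) (s, a) (\<sigma>, \<alpha>) \<ge> f * (norm \<sigma> * norm a - norm \<alpha>)\<^sup>2 +
    (1 - f) * (norm \<alpha>)\<^sup>2 + 4 * (norm \<sigma> * norm (drop_coord i a) - norm s * norm (drop_coord i \<alpha>))\<^sup>2"
proof -
  define x where "x = (norm s)\<^sup>2 - 1/2"
  have "x \<le> 1/2" using assms(2) by (simp add: x_def power_le_one)
  define A B where "A = (s \<bullet> \<sigma>) * (a \<bullet> \<alpha>) + (s \<bullet> scaleC \<i> \<sigma>) * (a \<bullet> scaleC \<i> \<alpha>)"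
    and "B = (s \<bullet> \<sigma>) * (drop_coord i a \<bullet> drop_coord i \<alpha>) +
      (s \<bullet> scaleC \<i> \<sigma>) * (drop_coord i a \<bullet> scaleC \<i> (drop_coord i \<alpha>))"
  have "\<bar>A\<bar> \<le> norm s * norm \<sigma> * norm a * norm \<alpha>"
    unfolding A_def by (rule hermitian_product_bound)
  also have "\<dots> \<le> norm \<sigma> * norm a * norm \<alpha>"
    using assms(2) mult_right_mono[OF assms(2), of "norm \<sigma> * norm a * norm \<alpha>"]
    by (simp add: mult_ac)
  finally have A: "f * A \<ge> - f * (norm \<sigma> * norm a * norm \<alpha>)"
    using mult_left_mono[of "- (norm \<sigma> * norm a * norm \<alpha>)" A f] flat_nonneg
    unfolding f_def by (simp add: abs_le_iff)
  have B: "B \<ge> - (norm s * norm \<sigma> * norm (drop_coord i a) * norm (drop_coord i \<alpha>))"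
    using hermitian_product_bound[of s \<sigma> "drop_coord i a" "drop_coord i \<alpha>"]
    unfolding B_def abs_le_iff by linarith
  have "levi_form (base i) (s, a) (\<sigma>, \<alpha>) =
     (flat 4 x - 2 * flat 3 x) * ((s \<bullet> \<sigma>)\<^sup>2 + (s \<bullet> scaleC \<i> \<sigma>)\<^sup>2) * (norm a)\<^sup>2 +
     f * (norm \<sigma>)\<^sup>2 * (norm a)\<^sup>2 + 2 * (f * A) + (1 + flat 0 x) * (norm \<alpha>)\<^sup>2 +
     4 * ((norm \<sigma>)\<^sup>2 * (norm (drop_coord i a))\<^sup>2 + 2 * B + (norm s)\<^sup>2 * (norm (drop_coord i \<alpha>))\<^sup>2)"
    unfolding levi_form_second_deriv scaleC_prod_def fst_conv snd_conv second_deriv_base[OF assms(1)]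
      x_def[symmetric] f_def A_def B_def clinear_scaleC[OF clinear_drop_coord] norm_scaleC_vec norm_ii
    by (simp add: field_simps)
  moreover have "(flat 4 x - 2 * flat 3 x) * ((s \<bullet> \<sigma>)\<^sup>2 + (s \<bullet> scaleC \<i> \<sigma>)\<^sup>2) * (norm a)\<^sup>2 \<ge> 0"
    using flat_4_3[OF \<open>x \<le> 1/2\<close>] by simp
  moreover have "flat 0 x * (norm \<alpha>)\<^sup>2 \<ge> 0" using flat_nonneg by simp
  ultimately show ?thesis
    using A B by (simp add: power2_eq_square algebra_simps)
qed

lemma levi_form_base_nonneg:
  fixes s \<sigma> :: "complex ^ 'm" and a \<alpha> :: "complex ^ 'r"
  assumes "a \<noteq> 0" "norm s \<le> 1"
  shows "levi_form (base i) (s, a) (\<sigma>, \<alpha>) \<ge> 0"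
  using levi_form_base_ge[OF assms, where i = i and \<sigma> = \<sigma> and \<alpha> = \<alpha>] flat_nonneg[of 2 "(norm s)\<^sup>2 - 1/2"]
    flat_2_less_1[of "(norm s)\<^sup>2 - 1/2"]
  by (smt (verit) mult_nonneg_nonneg zero_le_power2)

lemma levi_form_base_kernel:
  fixes s \<sigma> :: "complex ^ 'm" and a \<alpha> :: "complex ^ 'r"
  assumes "a \<noteq> 0" "norm s \<le> 1" "(\<sigma>, \<alpha>) \<noteq> 0" "levi_form (base i) (s, a) (\<sigma>, \<alpha>) = 0"
  shows "\<alpha> = 0" "\<sigma> \<noteq> 0" "(norm s)\<^sup>2 \<le> 1/2" "drop_coord i a = 0"
proof -
  define f where "f = flat 2 ((norm s)\<^sup>2 - 1/2)"
  have f: "0 \<le> f" "f < 1" by (simp_all add: f_def flat_nonneg flat_2_less_1)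
  define X Y Z where "X = f * (norm \<sigma> * norm a - norm \<alpha>)\<^sup>2" and "Y = (1 - f) * (norm \<alpha>)\<^sup>2"
    and "Z = 4 * (norm \<sigma> * norm (drop_coord i a) - norm s * norm (drop_coord i \<alpha>))\<^sup>2"
  have "X + Y + Z \<le> 0"
    using levi_form_base_ge[OF assms(1,2), where i = i and \<sigma> = \<sigma> and \<alpha> = \<alpha>]
    unfolding assms(4) X_def Y_def Z_def f_def .
  moreover have "X \<ge> 0" "Y \<ge> 0" "Z \<ge> 0" using f by (simp_all add: X_def Y_def Z_def)
  ultimately have 0: "X = 0" "Y = 0" "Z = 0" by linarith+
  show \<alpha>: "\<alpha> = 0" using 0(2) f by (simp add: Y_def)
  then show \<sigma>: "\<sigma> \<noteq> 0" using assms(3) by (simp add: zero_prod_def)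
  have "f = 0" using 0(1) \<alpha> \<sigma> assms(1) by (simp add: X_def)
  then show "(norm s)\<^sup>2 \<le> 1/2"
    using flat_pos[of "(norm s)\<^sup>2 - 1/2" 2] unfolding f_def by linarith
  have "drop_coord i \<alpha> = 0" using \<alpha> clinear_zero[OF clinear_drop_coord] by simp
  then show "drop_coord i a = 0" using 0(3) \<sigma> by (simp add: Z_def)
qed

lemma levi_form_pert1:
  fixes s \<sigma> :: "complex ^ 'm" and a :: "complex ^ 'r"
  assumes "i \<noteq> j" "a \<noteq> 0" "drop_coord i a = 0" "(norm s)\<^sup>2 \<le> 1/2"
  shows "levi_form (pert1 i j) (s, a) (\<sigma>, 0) = (norm a)\<^sup>2 * (norm \<sigma>)\<^sup>2"
proof -
  obtain z where z: "a = axis i z" using drop_coord_eq_zero[OF assms(3)] by blast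
  have n: "(norm a)\<^sup>2 = (cmod z)\<^sup>2" unfolding z by (rule norm_axis_square)
  have st: "stretch i a = a" unfolding z by (auto simp: stretch_def vec_eq_iff axis_def)
  have "second_deriv (pert1 i j) (s, a) (\<tau>, 0) = 2 * (norm a)\<^sup>2 * (norm \<tau>)\<^sup>2"
    for \<tau> :: "complex ^ 'm"
  proof -
    have "((\<lambda>t. (norm (s + t *\<^sub>R \<tau>))\<^sup>2) \<longlongrightarrow> (norm (s + 0 *\<^sub>R \<tau>))\<^sup>2) (nhds 0)"
      by (intro tendsto_intros filterlim_ident)
    then have "eventually (\<lambda>t. (norm (s + t *\<^sub>R \<tau>))\<^sup>2 < 5/8) (nhds 0)"
      by (rule order_tendstoD(2)) (use assms(4) in simp)
    then obtain d where d: "d > 0" "\<And>t. \<bar>t\<bar> < d \<Longrightarrow> (norm (s + t *\<^sub>R \<tau>))\<^sup>2 < 5/8"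
      by (auto simp: eventually_nhds_metric dist_real_def)
    show ?thesis
    proof (rule second_deriv_eqI[OF C_inf_on_pert1[OF assms(1)] _ d(1)])
      show "(s, a) \<in> punctured" using assms by simp
      show "pert1 i j ((s, a) + t *\<^sub>R (\<tau>, 0)) =
          (norm a)\<^sup>2 * (1/2 + ((norm s)\<^sup>2 + 2 * (s \<bullet> \<tau>) * t + (norm \<tau>)\<^sup>2 * t\<^sup>2))" if "\<bar>t\<bar> < d" for t
      proof -
        have "cutoff ((norm (s + t *\<^sub>R \<tau>))\<^sup>2) = 1"
          using d(2)[OF that] by (intro cutoff_eq_1) simp
        moreover have "quartic (hadamard i j a) = (norm a)\<^sup>2 / 2" "quartic a = (norm a)\<^sup>2"
          unfolding n unfolding z by (rule quartic_hadamard_axis[OF assms(1)] quartic_axis)+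
        ultimately have "pert1 i j ((s, a) + t *\<^sub>R (\<tau>, 0)) =
            (norm a)\<^sup>2 * (1/2 + (norm (s + t *\<^sub>R \<tau>))\<^sup>2)"
          by (simp add: pert1_def st) (simp add: field_simps)
        then show ?thesis by (simp only: norm_line)
      qed
      show "((\<lambda>t. (norm a)\<^sup>2 * (1/2 + ((norm s)\<^sup>2 + 2 * (s \<bullet> \<tau>) * t + (norm \<tau>)\<^sup>2 * t\<^sup>2)))
          has_real_derivative (norm a)\<^sup>2 * (2 * (s \<bullet> \<tau>) + 2 * (norm \<tau>)\<^sup>2 * t)) (at t)" for t
        by (auto intro!: derivative_eq_intros simp: algebra_simps)
      show "((\<lambda>t. (norm a)\<^sup>2 * (2 * (s \<bullet> \<tau>) + 2 * (norm \<tau>)\<^sup>2 * t)) has_real_derivative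
          2 * (norm a)\<^sup>2 * (norm \<tau>)\<^sup>2) (at 0)"
        by (auto intro!: derivative_eq_intros)
    qed
  qed
  from this[of \<sigma>] this[of "scaleC \<i> \<sigma>"] show ?thesis
    by (simp add: levi_form_second_deriv scaleC_prod_def complex_vector.scale_zero_right norm_scaleC_vec)
qed

lemma levi_form_family:
  fixes p w :: "(complex ^ 'm) \<times> (complex ^ 'r)"
  assumes "i \<noteq> j" "p \<in> punctured"
  shows "levi_form (family i j e) p w =
    levi_form (base i) p w + e * levi_form (pert1 i j) p w + e\<^sup>2 * levi_form (pert2 i) p w"
proof -
  note C = C_inf_on_mult[OF C_inf_on_const[OF open_punctured] C_inf_on_pert1[OF assms(1)]]
    C_inf_on_mult[OF C_inf_on_const[OF open_punctured] C_inf_on_pert2]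
  have "levi_form (family i j e) p w =
      levi_form (\<lambda>p. base i p + e * pert1 i j p + e\<^sup>2 * pert2 i p) p w"
    by (simp only: family_def[abs_def])
  then show ?thesis
    by (simp only: levi_form_add[OF C_inf_on_add[OF C_inf_on_base C(1)] C(2) assms(2)]
        levi_form_add[OF C_inf_on_base C(1) assms(2)]
        levi_form_cmult[OF C_inf_on_pert1[OF assms(1)] assms(2)]
        levi_form_cmult[OF C_inf_on_pert2 assms(2)])
qed

lemma levi_form_family_homogeneous:
  fixes s \<sigma> :: "complex ^ 'm" and a \<alpha> :: "complex ^ 'r"
  assumes "i \<noteq> j" "a \<noteq> 0" "c \<noteq> 0"
  shows "levi_form (family i j e) (s, c *\<^sub>R a) (\<sigma>, c *\<^sub>R \<alpha>) = c\<^sup>2 * levi_form (family i j e) (s, a) (\<sigma>, \<alpha>)"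
proof -
  let ?L = "\<lambda>p :: (complex ^ 'm) \<times> (complex ^ 'r). (fst p, c *\<^sub>R snd p)"
  have L: "bounded_linear ?L"
    by (intro bounded_linear_Pair bounded_linear_fst bounded_linear_scaleR_const bounded_linear_snd
        bounded_linear_compose[OF bounded_linear_scaleR_right])
  have "levi_form (\<lambda>p. family i j e (?L p)) (s, a) (\<sigma>, \<alpha>) =
      levi_form (family i j e) (?L (s, a)) (?L (\<sigma>, \<alpha>))"
    using assms
    by (intro levi_form_linear_compose[OF C_inf_on_family[OF assms(1)] L])
      (simp_all add: scaleC_prod_def linear_scale[OF linear_scaleC])
  moreover have "family i j e (?L p) = c\<^sup>2 * family i j e p" for p :: "(complex ^ 'm) \<times> (complex ^ 'r)"
    using family_scaleC[of i j e "fst p" "complex_of_real c" "snd p"] by (simp add: scaleR_scaleC)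
  moreover have "levi_form (\<lambda>p. c\<^sup>2 * family i j e p) (s, a) (\<sigma>, \<alpha>) =
      c\<^sup>2 * levi_form (family i j e) (s, a) (\<sigma>, \<alpha>)"
    using assms(2) by (intro levi_form_cmult[OF C_inf_on_family[OF assms(1)]]) simp
  ultimately show ?thesis by simp
qed

lemma family_small_parameter:
  fixes i j :: "'r::finite"
  assumes "i \<noteq> j"
  obtains e where "0 < e" "e < 1"
    "\<And>(s :: complex ^ 'm) (a :: complex ^ 'r). norm s \<le> 1 \<Longrightarrow> a \<noteq> 0 \<Longrightarrow> family i j e (s, a) > 0"
    "\<And>(s :: complex ^ 'm) (a :: complex ^ 'r) w. norm s \<le> 1 \<Longrightarrow> a \<noteq> 0 \<Longrightarrow> w \<noteq> 0 \<Longrightarrow>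
       levi_form (family i j e) (s, a) w > 0"
proof -
  let ?S = "cball 0 1 \<times> sphere 0 1 :: ((complex ^ 'm) \<times> (complex ^ 'r)) set"
  have S: "?S \<subseteq> punctured" by auto
  have "compact ?S" by (intro compact_Times) auto
  have c: "continuous_on ?S f" if "C_inf_on punctured f" for f
    using C_inf_on_imp_continuous_on[OF that] S by (rule continuous_on_subset)
  have pos: "base i p > 0" if "p \<in> ?S" for p :: "(complex ^ 'm) \<times> (complex ^ 'r)"
    using that flat_nonneg[of 0 "(norm (fst p))\<^sup>2 - 1/2"]
    by (simp add: base_def mem_Times_iff add_pos_nonneg)
  have pos': "pert1 i j p > 0" if "p \<in> ?S" "base i p = 0" for p :: "(complex ^ 'm) \<times> (complex ^ 'r)"
    using pos[OF that(1)] that(2) by simp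
  obtain e1 where e1: "e1 > 0" "\<And>e p. 0 < e \<Longrightarrow> e < e1 \<Longrightarrow> p \<in> ?S \<Longrightarrow>
      base i p + e * pert1 i j p + e\<^sup>2 * pert2 i p > 0"
    by (rule compact_perturbation_pos[OF \<open>compact ?S\<close> c[OF C_inf_on_base]
          c[OF C_inf_on_pert1[OF assms]] c[OF C_inf_on_pert2[of i]] less_imp_le[OF pos] pos'])
      (assumption | rule that)+
  let ?K = "?S \<times> (sphere 0 1 :: ((complex ^ 'm) \<times> (complex ^ 'r)) set)"
  have "compact ?K" by (rule compact_Times[OF \<open>compact ?S\<close> compact_sphere])
  have cl: "continuous_on ?K (\<lambda>(p, w). levi_form f p w)" if "C_inf_on punctured f" for f
    using continuous_on_levi_form[OF that] by (rule continuous_on_subset) (use S in blast)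
  have K1: "(case x of (p, w) \<Rightarrow> levi_form (base i) p w) \<ge> 0" if x: "x \<in> ?K" for x
  proof -
    obtain s a \<sigma> \<alpha> where eq: "x = ((s, a), (\<sigma>, \<alpha>))" by (metis surj_pair)
    have "a \<noteq> 0" "norm s \<le> 1" using x unfolding eq by auto
    then show ?thesis unfolding eq using levi_form_base_nonneg[of a s i \<sigma> \<alpha>] by simp
  qed
  have K2: "(case x of (p, w) \<Rightarrow> levi_form (pert1 i j) p w) > 0"
    if x: "x \<in> ?K" "(case x of (p, w) \<Rightarrow> levi_form (base i) p w) = 0" for x
  proof -
    obtain s a \<sigma> \<alpha> where eq: "x = ((s, a), (\<sigma>, \<alpha>))" by (metis surj_pair)
    have a: "a \<noteq> 0" and s: "norm s \<le> 1" and w: "(\<sigma>, \<alpha>) \<noteq> 0"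
      using x(1) unfolding eq by auto
    have z: "levi_form (base i) (s, a) (\<sigma>, \<alpha>) = 0" using x(2) unfolding eq by simp
    note k = levi_form_base_kernel[OF a s w z]
    have "levi_form (pert1 i j) (s, a) (\<sigma>, \<alpha>) = (norm a)\<^sup>2 * (norm \<sigma>)\<^sup>2"
      unfolding k(1) by (rule levi_form_pert1[OF assms a k(4,3)])
    then show ?thesis unfolding eq using a k(2) by simp
  qed
  obtain e2 where e2: "e2 > 0" "\<And>e x. 0 < e \<Longrightarrow> e < e2 \<Longrightarrow> x \<in> ?K \<Longrightarrow>
      (case x of (p, w) \<Rightarrow> levi_form (base i) p w) + e * (case x of (p, w) \<Rightarrow> levi_form (pert1 i j) p w) +
      e\<^sup>2 * (case x of (p, w) \<Rightarrow> levi_form (pert2 i) p w) > 0"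
    by (rule compact_perturbation_pos[OF \<open>compact ?K\<close> cl[OF C_inf_on_base]
          cl[OF C_inf_on_pert1[OF assms]] cl[OF C_inf_on_pert2[of i]] K1 K2])
      (assumption | rule that)+
  define e where "e = min 1 (min e1 e2) / 2"
  have e: "0 < e" "e < 1" "e < e1" "e < e2" using e1(1) e2(1) by (auto simp: e_def)
  show thesis
  proof (rule that[OF e(1,2)])
    fix s :: "complex ^ 'm" and a :: "complex ^ 'r"
    assume s: "norm s \<le> 1" and a: "a \<noteq> 0"
    define b where "b = a /\<^sub>R norm a"
    have b: "norm b = 1" "b \<noteq> 0" "a = norm a *\<^sub>R b" using a by (auto simp: b_def)
    have "family i j e (s, b) > 0"
      using e1(2)[OF e(1,3), of "(s, b)"] s b(1) by (simp add: family_def)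
    then have "(norm a)\<^sup>2 * family i j e (s, b) > 0" using a by simp
    moreover have "family i j e (s, a) = (norm a)\<^sup>2 * family i j e (s, b)"
      using family_scaleC[of i j e s "complex_of_real (norm a)" b] b(3) by (simp add: scaleR_scaleC)
    ultimately show "family i j e (s, a) > 0" by simp
    fix w :: "(complex ^ 'm) \<times> (complex ^ 'r)" assume "w \<noteq> 0"
    define v where "v = (fst w, snd w /\<^sub>R norm a)"
    have "v \<noteq> 0" using \<open>w \<noteq> 0\<close> a by (auto simp: v_def zero_prod_def prod_eq_iff)
    define u where "u = v /\<^sub>R norm v"
    have u: "norm u = 1" "v = norm v *\<^sub>R u" using \<open>v \<noteq> 0\<close> by (auto simp: u_def)
    have sb: "(s, b) \<in> punctured" using b(2) by simp
    have "levi_form (family i j e) (s, b) u > 0"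
      using e2(2)[OF e(1,4), of "((s, b), u)"] s b(1) u(1)
      by (simp add: levi_form_family[OF assms sb])
    then have "levi_form (family i j e) (s, b) v > 0"
      using levi_form_scaleR[OF C_inf_on_family[OF assms] sb, of e "norm v" u] u(2) \<open>v \<noteq> 0\<close> by simp
    then have "(norm a)\<^sup>2 * levi_form (family i j e) (s, b) (fst v, snd v) > 0" using a by simp
    then have "levi_form (family i j e) (s, norm a *\<^sub>R b) (fst v, norm a *\<^sub>R snd v) > 0"
      using a b(2) by (simp add: levi_form_family_homogeneous[OF assms])
    moreover have "(fst v, norm a *\<^sub>R snd v) = w" using a by (simp add: v_def)
    ultimately show "levi_form (family i j e) (s, a) w > 0" using b(3) by simp
  qed
qed

subsection \<open>Symmetries of the model norm\<close>

definition model :: "real \<Rightarrow> complex ^ 'r::finite \<Rightarrow> real" where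
  "model e a = (norm a)\<^sup>2 + e * quartic a"

definition flip_coord :: "'r::finite \<Rightarrow> complex ^ 'r \<Rightarrow> complex ^ 'r" where
  "flip_coord i z = (\<chi> j. if j = i then - z $ j else z $ j)"

definition swap_coords :: "'r::finite \<Rightarrow> 'r \<Rightarrow> complex ^ 'r \<Rightarrow> complex ^ 'r" where
  "swap_coords i j z = (\<chi> l. z $ Transposition.transpose i j l)"

lemma clinear_iso_involution:
  assumes "clinear f" "\<And>z. f (f z) = z"
  shows "clinear_iso f"
  using assms o_bij[of f f] by (simp add: clinear_iso_def fun_eq_iff)

lemma clinear_iso_flip_coord: "clinear_iso (flip_coord i)"
  by (rule clinear_iso_involution) (simp_all add: clinear_iff flip_coord_def vec_eq_iff)

lemma clinear_iso_swap_coords: "clinear_iso (swap_coords i j)"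
  by (rule clinear_iso_involution) (simp_all add: clinear_iff swap_coords_def vec_eq_iff)

lemma clinear_iso_hadamard: "i \<noteq> j \<Longrightarrow> clinear_iso (hadamard i j)"
  by (rule clinear_iso_involution) (simp_all add: clinear_hadamard hadamard_hadamard)

lemma sum_transpose: "(\<Sum>l\<in>UNIV. f (Transposition.transpose i j l)) = (\<Sum>l\<in>UNIV. f l)"
  by (rule sum.reindex_bij_betw) simp

lemma model_flip_coord: "model e (flip_coord i a) = model e a"
proof -
  have "cmod (flip_coord i a $ l) = cmod (a $ l)" for l by (simp add: flip_coord_def)
  then show ?thesis by (simp add: model_def quartic_def norm_square_vec)
qed

lemma model_swap_coords: "model e (swap_coords i j a) = model e a"
  using sum_transpose[of "\<lambda>l. (cmod (a $ l))\<^sup>2" i j] sum_transpose[of "\<lambda>l. cmod (a $ l) ^ 4" i j]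
  by (simp add: model_def quartic_def norm_square_vec swap_coords_def)

lemma functional_flip_coord: "functional id (flip_coord i a) (flip_coord i z) = functional id a z"
  unfolding functional_def by (intro sum.cong) (simp_all add: flip_coord_def)

lemma functional_swap_coords:
  "functional id (swap_coords i j a) (swap_coords i j z) = functional id a z"
  unfolding functional_def swap_coords_def
  using sum_transpose[of "\<lambda>l. a $ l * z $ l" i j] by simp

lemma functional_hadamard:
  assumes "i \<noteq> j"
  shows "functional id (hadamard i j a) (hadamard i j z) = functional id a z"
proof -
  have "(a + b) / complex_of_real (sqrt 2) * ((x + y) / complex_of_real (sqrt 2)) +
      (a - b) / complex_of_real (sqrt 2) * ((x - y) / complex_of_real (sqrt 2)) = a * x + b * y"
    for a b x y
    unfolding times_divide_times_eq sqrt2_mult by (simp add: field_simps)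
  then show ?thesis
    unfolding functional_def sum_split_two[OF assms] add.assoc[symmetric]
    using assms by (simp add: hadamard_def)
qed

lemma dual_norm_model:
  assumes "e \<ge> 0"
  shows "dual_norm (model e)"
proof -
  have "model e a > 0" if "a \<noteq> 0" for a :: "complex ^ 'r"
    using that assms quartic_nonneg[of a] unfolding model_def by (intro add_pos_nonneg) auto
  then show ?thesis
    unfolding dual_norm_def
    by (auto simp: model_def quartic_scaleC norm_scaleC_vec power_mult_distrib algebra_simps)
qed

lemma model_in_K_metrics:
  fixes i j :: "'r::finite"
  assumes "i \<noteq> j" "e \<ge> 0"
    and levi: "\<And>(a :: complex ^ 'r) w. a \<noteq> 0 \<Longrightarrow> w \<noteq> 0 \<Longrightarrow>
      levi_form (family i j e) (0 :: complex ^ 'm, a) w > 0"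
  shows "restrict (metric_of_dual id (model e :: complex ^ 'r \<Rightarrow> real)) O1 \<in> K_metrics TYPE('r)"
proof (rule positively_curved_metric_of_dual[OF _ clinear_iso_id dual_norm_model[OF assms(2)]])
  let ?L = "\<lambda>a. (0 :: complex ^ 'm, hadamard i j a)"
  have L: "bounded_linear ?L"
    by (intro bounded_linear_Pair bounded_linear_zero bounded_linear_clinear clinear_hadamard)
  have eq: "model e = (\<lambda>a. family i j e (?L a))"
    by (simp add: model_def family_center[OF assms(1)] hadamard_hadamard[OF assms(1)] fun_eq_iff)
  show "complex_vector.dim (UNIV :: (complex ^ 'r) set) \<noteq> 0" by (simp add: complex_dim_vec)
  have L0: "?L a \<in> punctured" if "a \<noteq> 0" for a
    using hadamard_nonzero[OF assms(1) that] by simp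
  show "C_inf_on (-{0}) (model e :: complex ^ 'r \<Rightarrow> real)"
    unfolding eq by (rule C_inf_on_linear_compose[OF C_inf_on_family[OF assms(1)] _ L])
      (use L0 in \<open>simp_all add: open_Compl\<close>)
  fix a w :: "complex ^ 'r" assume a: "a \<noteq> 0" and w: "w \<noteq> 0"
  have "levi_form (model e) a w = levi_form (family i j e) (?L a) (?L w)"
    unfolding eq
    by (rule levi_form_linear_compose[OF C_inf_on_family[OF assms(1)] L])
      (use L0[OF a] in \<open>simp_all add: scaleC_prod_def clinear_scaleC[OF clinear_hadamard]
        complex_vector.scale_zero_right\<close>)
  then show "levi_form (model e) a w > 0"
    using levi hadamard_nonzero[OF assms(1)] a w by (simp add: zero_prod_def)
qed

lemma equivariant_model:
  fixes \<Psi> :: "((complex ^ 'r::finite) set \<times> (complex ^ 'r) set \<Rightarrow> real) \<Rightarrow> (complex ^ 'r \<Rightarrow> real)"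
  assumes \<Psi>: "GL_equivariant \<Psi>" and "e \<ge> 0"
    and K: "restrict (metric_of_dual id (model e :: complex ^ 'r \<Rightarrow> real)) O1 \<in> K_metrics TYPE('r)"
  obtains c where "c > 0"
    "\<And>z. \<Psi> (restrict (metric_of_dual id (model e)) O1) z = c * (norm z)\<^sup>2"
proof -
  let ?H = "\<Psi> (restrict (metric_of_dual id (model e)) O1)"
  note M = dual_norm_model[OF assms(2)]
  have inv: "?H (\<phi> z) = ?H z"
    if "clinear_iso \<phi>" "\<And>a. model e (\<phi> a) = model e a"
      "\<And>a z. functional id (\<phi> a) (\<phi> z) = functional id a z"
    for \<phi> :: "complex ^ 'r \<Rightarrow> complex ^ 'r" and z
  proof -
    have MA: "(\<lambda>a. model e (\<phi> a)) = model e" using that(2) by (simp add: fun_eq_iff)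
    have "dual_norm (\<lambda>a. model e (\<phi> a))" unfolding MA by (rule M)
    from equivariant_metric_of_dual[OF \<Psi> M this K that(1,3)]
    have "?H = ?H \<circ> \<phi>" unfolding MA .
    from fun_cong[OF this, of z] show ?thesis by simp
  qed
  have "?H \<in> H_metrics" using \<Psi> K by (auto simp: GL_equivariant_def)
  then show thesis
  proof (rule invariant_hermitian_metric)
    show "?H (\<chi> j. if j = i then - z $ j else z $ j) = ?H z" for i z
      unfolding flip_coord_def[symmetric]
      by (rule inv[OF clinear_iso_flip_coord model_flip_coord functional_flip_coord])
    show "?H (\<chi> l. z $ Transposition.transpose i j l) = ?H z" for i j z
      unfolding swap_coords_def[symmetric]
      by (rule inv[OF clinear_iso_swap_coords model_swap_coords functional_swap_coords])
  qed (rule that)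
qed

subsection \<open>Violation of the sub-mean value inequality\<close>

definition rescale :: "('r::finite \<Rightarrow> real) \<Rightarrow> complex ^ 'r \<Rightarrow> complex ^ 'r" where
  "rescale d z = (\<chi> l. complex_of_real (d l) * z $ l)"

lemma clinear_iso_rescale:
  assumes "\<And>l. d l \<noteq> 0"
  shows "clinear_iso (rescale d)"
proof -
  have "rescale d (rescale (\<lambda>l. 1 / d l) z) = z" "rescale (\<lambda>l. 1 / d l) (rescale d z) = z" for z
    using assms by (simp_all add: rescale_def vec_eq_iff)
  then have "bij (rescale d)"
    by (intro o_bij[of "rescale (\<lambda>l. 1 / d l)"]) (simp_all add: fun_eq_iff)
  then show ?thesis
    by (simp add: clinear_iso_def clinear_iff rescale_def vec_eq_iff algebra_simps)
qed

lemma functional_rescale: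
  assumes "\<And>l. d l \<noteq> 0"
  shows "functional id (rescale d a) (rescale (\<lambda>l. 1 / d l) z) = functional id a z"
  unfolding functional_def using assms by (intro sum.cong) (simp_all add: rescale_def)

lemma equivariant_family:
  fixes \<Psi> :: "((complex ^ 'r::finite) set \<times> (complex ^ 'r) set \<Rightarrow> real) \<Rightarrow> (complex ^ 'r \<Rightarrow> real)"
    and s :: "complex ^ 'm"
  assumes \<Psi>: "GL_equivariant \<Psi>" and ij: "i \<noteq> j" and e: "0 < e" "e < 1"
    and K: "restrict (metric_of_dual id (model e :: complex ^ 'r \<Rightarrow> real)) O1 \<in> K_metrics TYPE('r)"
    and N: "dual_norm (\<lambda>a. family i j e (s, a))"
    and c: "\<And>z. \<Psi> (restrict (metric_of_dual id (model e)) O1) z = c * (norm z)\<^sup>2"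
  shows "s = 0 \<Longrightarrow> \<Psi> (restrict (metric_of_dual id (\<lambda>a. family i j e (s, a))) O1) z =
      c * (\<Sum>l\<in>UNIV. (cmod (z $ l))\<^sup>2 / 1)"
    and "norm s = 1/2 \<Longrightarrow> \<Psi> (restrict (metric_of_dual id (\<lambda>a. family i j e (s, a))) O1) z =
      c * (\<Sum>l\<in>UNIV. (cmod (z $ l))\<^sup>2 / ((1 - e / 4) * (if l = i then 1 else 2)))"
proof -
  note M = dual_norm_model[OF less_imp_le[OF e(1)]]
  have gen: "\<Psi> (restrict (metric_of_dual id (\<lambda>a. family i j e (s, a))) O1) z = c * (norm (\<phi> z))\<^sup>2"
    if "\<And>a. family i j e (s, a) = model e (A a)" "clinear_iso \<phi>"
      "\<And>a z. functional id (A a) (\<phi> z) = functional id a z"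
    for \<phi> A :: "complex ^ 'r \<Rightarrow> complex ^ 'r"
  proof -
    have eq: "(\<lambda>a. family i j e (s, a)) = (\<lambda>a. model e (A a))" using that(1) by (rule ext)
    have "dual_norm (\<lambda>a. model e (A a))" using N unfolding eq .
    from fun_cong[OF equivariant_metric_of_dual[OF \<Psi> M this K that(2,3)], of z]
    show ?thesis unfolding eq comp_apply c .
  qed
  show "\<Psi> (restrict (metric_of_dual id (\<lambda>a. family i j e (s, a))) O1) z =
      c * (\<Sum>l\<in>UNIV. (cmod (z $ l))\<^sup>2 / 1)" if s: "s = 0"
  proof -
    have "family i j e (s, a) = model e (hadamard i j a)" for a
      unfolding s family_center[OF ij] model_def ..
    from gen[OF this clinear_iso_hadamard[OF ij] functional_hadamard[OF ij]]
    show ?thesis by (simp only: norm_hadamard[OF ij] norm_square_vec[of z] div_by_1)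
  qed
  show "\<Psi> (restrict (metric_of_dual id (\<lambda>a. family i j e (s, a))) O1) z =
      c * (\<Sum>l\<in>UNIV. (cmod (z $ l))\<^sup>2 / ((1 - e / 4) * (if l = i then 1 else 2)))"
    if s: "norm s = 1/2"
  proof -
    define d where "d l = sqrt (1 - e / 4) * (if l = i then 1 else sqrt 2)" for l
    have d0: "d l \<noteq> 0" for l using e by (simp add: d_def)
    have d2: "(d l)\<^sup>2 = (1 - e / 4) * (if l = i then 1 else 2)" for l
      using e by (simp add: d_def power_mult_distrib)
    have re: "rescale d a = scaleC (complex_of_real (sqrt (1 - e / 4))) (stretch i a)" for a
      by (simp add: rescale_def stretch_def d_def vec_eq_iff)
    have "family i j e (s, a) = model e (rescale d a)" for a
      unfolding family_circle[OF s] re model_def quartic_scaleC norm_scaleC_vec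
      using e by (simp add: power_mult_distrib algebra_simps)
    from gen[OF this clinear_iso_rescale functional_rescale[OF d0]] d0
    have "\<Psi> (restrict (metric_of_dual id (\<lambda>a. family i j e (s, a))) O1) z =
        c * (norm (rescale (\<lambda>l. 1 / d l) z))\<^sup>2" by simp
    also have "(norm (rescale (\<lambda>l. 1 / d l) z))\<^sup>2 = (\<Sum>l\<in>UNIV. (cmod (z $ l))\<^sup>2 / (d l)\<^sup>2)"
      unfolding norm_square_vec
      by (intro sum.cong) (simp_all add: rescale_def norm_mult norm_divide power_mult_distrib power_divide)
    finally show ?thesis unfolding d2 .
  qed
qed

lemma not_psh_on_circle:
  fixes u :: "(complex ^ 'm) \<times> (complex ^ 'r) \<Rightarrow> real"
  assumes "\<And>s. norm s = 1/2 \<Longrightarrow> u (s, b) = u1" "u (0, b) = u0" "u1 < u0" "\<rho> > 1/2"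
  shows "\<not> psh_on (ball 0 \<rho> \<times> UNIV) u"
proof
  assume psh: "psh_on (ball 0 \<rho> \<times> UNIV) u"
  fix m :: 'm
  define w :: "(complex ^ 'm) \<times> (complex ^ 'r)" where "w = (axis m (1/2), 0)"
  have w: "(0, b) + scaleC \<zeta> w = (scaleC \<zeta> (axis m (1/2)), b)" for \<zeta>
    by (simp add: w_def scaleC_prod_def complex_vector.scale_zero_right)
  have n: "norm (scaleC \<zeta> (axis m (1/2)) :: complex ^ 'm) = cmod \<zeta> / 2" for \<zeta>
  proof -
    have "(norm (axis m (1/2) :: complex ^ 'm))\<^sup>2 = (1/2)\<^sup>2"
      unfolding norm_axis_square by (simp add: norm_divide)
    then have "norm (axis m (1/2) :: complex ^ 'm) = 1/2"
      by (rule power2_eq_imp_eq) auto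
    then show ?thesis by (simp add: norm_scaleC_vec)
  qed
  have "(0, b) + scaleC \<zeta> w \<in> ball 0 \<rho> \<times> UNIV" if "cmod \<zeta> \<le> 1" for \<zeta>
    unfolding w using that assms(4) by (simp add: n)
  then have "u (0, b) \<le> integral {0..2 * pi} (\<lambda>\<theta>. u ((0, b) + scaleC (cis \<theta>) w)) / (2 * pi)"
    using psh unfolding psh_on_def by blast
  moreover have "u ((0, b) + scaleC (cis \<theta>) w) = u1" for \<theta>
    unfolding w by (rule assms(1)) (simp add: n)
  ultimately have "u0 \<le> u1" using assms(2) by simp
  then show False using assms(3) by simp
qed

theorem theorem4p1:
  assumes "CARD('m::finite) \<ge> 1" and "CARD('r::finite) \<ge> 2"
    and "complex_vector.dim (UNIV :: 'v::complex_vector set) = CARD('r)"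
  shows "\<exists>(k :: (complex ^ 'm) \<times> 'v set \<times> 'v set \<Rightarrow> real) \<rho> \<rho>'.
    positively_curved_O1_over TYPE('r) (ball 0 1) k \<and>
    0 < \<rho> \<and> \<rho> < \<rho>' \<and> \<rho>' < 1 \<and>
    (\<forall>\<Psi> :: ((complex ^ 'r) set \<times> (complex ^ 'r) set \<Rightarrow> real) \<Rightarrow> (complex ^ 'r \<Rightarrow> real).
       GL_equivariant \<Psi> \<longrightarrow>
       \<not> semipositively_curved_over TYPE('r) (ball 0 \<rho>) (fiberwise_map \<Psi> k)) \<and>
    (\<exists>h :: (complex ^ 'm) \<times> 'v \<Rightarrow> real.
       smooth_metric_over TYPE('r) (ball 0 1 - ball 0 \<rho>') h \<and>
       (\<forall>s\<in>ball 0 1 - ball 0 \<rho>'. \<forall>p\<in>O1. k (s, p) = k_of h (s, p)))"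
proof -
  have "\<exists>i j :: 'r. i \<noteq> j"
  proof (rule ccontr)
    assume "\<not> ?thesis"
    then have "card (UNIV :: 'r set) \<le> 1" by (simp add: card_le_Suc0_iff_eq)
    then show False using assms(2) by simp
  qed
  then obtain i j :: 'r where ij: "i \<noteq> j" by blast
  have dim: "complex_vector.dim (UNIV :: 'v set) \<noteq> 0" using assms(3) by simp
  have dim': "complex_vector.dim (UNIV :: (complex ^ 'r) set) \<noteq> 0" by (simp add: complex_dim_vec)
  define \<psi> where "\<psi> = (SOME \<psi> :: complex ^ 'r \<Rightarrow> 'v. clinear_iso \<psi>)"
  obtain \<psi>0 :: "complex ^ 'r \<Rightarrow> 'v" where "clinear_iso \<psi>0" using clinear_iso_exists[OF assms(3)] .
  then have \<psi>: "clinear_iso \<psi>" unfolding \<psi>_def by (rule someI[where P = clinear_iso])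
  define y where "y = inv \<psi>"
  have y: "clinear_iso y" unfolding y_def using \<psi> by (rule clinear_iso_inv)
  have y\<psi>: "y \<circ> \<psi> = id"
    unfolding y_def using \<psi> by (simp add: clinear_iso_def bij_is_inj)
  obtain e where e: "0 < e" "e < 1"
    and pos: "\<And>(s :: complex ^ 'm) (a :: complex ^ 'r). norm s \<le> 1 \<Longrightarrow> a \<noteq> 0 \<Longrightarrow> family i j e (s, a) > 0"
    and levi: "\<And>(s :: complex ^ 'm) (a :: complex ^ 'r) w. norm s \<le> 1 \<Longrightarrow> a \<noteq> 0 \<Longrightarrow> w \<noteq> 0 \<Longrightarrow>
       levi_form (family i j e) (s, a) w > 0"
    using family_small_parameter[OF ij] by metis
  define N where "N s = (\<lambda>a. family i j e (s, a))" for s :: "complex ^ 'm"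
  have N: "dual_norm (N s)" if "norm s \<le> 1" for s
    unfolding dual_norm_def N_def using pos[OF that] family_scaleC by blast
  define k where "k = (\<lambda>(s, p). metric_of_dual y (N s) p)"
  have curved: "positively_curved_O1_over TYPE('r) (ball 0 1) k"
    unfolding k_def N_def
    by (rule positively_curved_metric_of_dual_over[OF dim y open_ball N[unfolded N_def]
          C_inf_on_family[OF ij] levi]) simp_all
  have K: "restrict (metric_of_dual id (model e :: complex ^ 'r \<Rightarrow> real)) O1 \<in> K_metrics TYPE('r)"
    using e(1) levi[of 0] by (intro model_in_K_metrics[OF ij]) simp_all
  have fib: "fiberwise_map \<Psi> k (s, v) = \<Psi> (restrict (metric_of_dual id (N s)) O1) (y v)"
    if "norm s \<le> 1" for \<Psi> s v
  proof -
    have "pull_K \<psi> (\<lambda>p\<in>O1. k (s, p)) = restrict (metric_of_dual (y \<circ> \<psi>) (N s)) O1"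
      using pull_K_metric_of_dual[OF dim dim' y N[OF that] \<psi>] by (simp add: k_def)
    then show ?thesis
      unfolding y\<psi> by (simp add: fiberwise_map_def transfer_map_def Let_def \<psi>_def[symmetric]
          pull_H_def y_def)
  qed
  have not_curved: "\<not> semipositively_curved_over TYPE('r) (ball 0 (3/5)) (fiberwise_map \<Psi> k)"
    if \<Psi>: "GL_equivariant \<Psi>"
    for \<Psi> :: "((complex ^ 'r) set \<times> (complex ^ 'r) set \<Rightarrow> real) \<Rightarrow> (complex ^ 'r \<Rightarrow> real)"
  proof -
    obtain c where c: "c > 0" "\<And>z. \<Psi> (restrict (metric_of_dual id (model e)) O1) z = c * (norm z)\<^sup>2"
      by (rule equivariant_model[OF \<Psi> less_imp_le[OF e(1)] K]) (rule that)
    have N': "dual_norm (\<lambda>a. family i j e (s, a))" if "norm s \<le> 1" for s :: "complex ^ 'm"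
      using N[OF that] unfolding N_def .
    let ?u = "\<lambda>(s, a). dual_metric id (\<lambda>v. fiberwise_map \<Psi> k (s, v)) (functional y a)"
    have u1: "?u (s, axis i 1) = (1 - e / 4) / c" if s: "norm s = 1/2" for s
    proof -
      have s1: "norm s \<le> 1" using s by simp
      have "dual_metric id (\<lambda>v. fiberwise_map \<Psi> k (s, v)) (functional y (axis i 1)) =
          (1 - e / 4) * (if i = i then 1 else 2) / c"
        using e(2) by (intro dual_metric_diagonal[OF y _ c(1)])
          (simp, simp only: fib[OF s1] N_def equivariant_family(2)[OF \<Psi> ij e K N'[OF s1] c(2) s])
      then show ?thesis by simp
    qed
    have "dual_metric id (\<lambda>v. fiberwise_map \<Psi> k (0, v)) (functional y (axis i 1)) = 1 / c"
      by (intro dual_metric_diagonal[OF y _ c(1)])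
        (simp, simp only: fib[of 0] norm_zero zero_le_one N_def equivariant_family(1)[OF \<Psi> ij e K N'[of 0] c(2) refl])
    then have u0: "?u (0, axis i 1) = 1 / c" by simp
    have "\<not> psh_on (ball 0 (3/5) \<times> UNIV) ?u"
      by (rule not_psh_on_circle[where u = ?u, OF u1 u0]) (use e(1) c(1) in \<open>simp_all add: divide_strict_right_mono\<close>)
    then show ?thesis unfolding semipositively_curved_over_def using y by blast
  qed
  define l where "l s = (\<lambda>n. 1 + flat 0 ((norm s)\<^sup>2 - 1/2) + (if n = i then 0 else 4 * (norm s)\<^sup>2))"
    for s :: "complex ^ 'm"
  have l: "l s n > 0" for s n
    unfolding l_def using flat_nonneg[of 0 "(norm s)\<^sup>2 - 1/2"] by (simp add: add_pos_nonneg)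
  define h where "h = (\<lambda>(s, v). \<Sum>n\<in>UNIV. (cmod (y v $ n))\<^sup>2 / l s n)"
  have "smooth_metric_over TYPE('r) (ball 0 1 - ball 0 (9/10)) h"
    unfolding smooth_metric_over_def metric_over_def
  proof (intro conjI ballI allI impI)
    fix s :: "complex ^ 'm"
    show "hermitian_metric id (\<lambda>v. h (s, v))"
      unfolding h_def prod.case by (rule hermitian_metric_diagonal[OF y l])
  next
    fix x :: "complex ^ 'r \<Rightarrow> 'v" assume "clinear_iso x"
    then have yx: "bounded_linear (y \<circ> x)"
      using y by (intro bounded_linear_clinear clinear_compose) (simp_all add: clinear_iso_def)
    have yxn: "bounded_linear (\<lambda>p :: (complex ^ 'm) \<times> (complex ^ 'r). (y \<circ> x) (snd p) $ n)" for n
      by (intro bounded_linear_compose[OF bounded_linear_vec_nth]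
          bounded_linear_compose[OF yx] bounded_linear_snd)
    have lC: "C_inf_on UNIV (\<lambda>p :: (complex ^ 'm) \<times> (complex ^ 'r). l (fst p) n)" for n
    proof -
      have n: "C_inf_on UNIV (\<lambda>p :: (complex ^ 'm) \<times> (complex ^ 'r). (norm (fst p))\<^sup>2)"
        by (rule C_inf_on_norm_square[OF bounded_linear_fst open_UNIV])
      show ?thesis
        unfolding l_def
        by (cases "n = i") (simp_all add: C_inf_on_add C_inf_on_flat C_inf_on_diff C_inf_on_mult
            C_inf_on_const n)
    qed
    have "C_inf_on UNIV (\<lambda>p :: (complex ^ 'm) \<times> (complex ^ 'r).
        \<Sum>n\<in>UNIV. (norm ((y \<circ> x) (snd p) $ n))\<^sup>2 / l (fst p) n)"
      using l by (intro C_inf_on_sum C_inf_on_divide C_inf_on_norm_square[OF yxn] lC open_UNIV)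
        (simp add: less_imp_neq[symmetric])
    then show "smooth_on ((ball 0 1 - ball 0 (9/10)) \<times> UNIV) (\<lambda>(s, z). h (s, x z))"
      by (rule C_inf_on_imp_smooth_on) (auto simp: h_def)
  qed
  moreover have "k (s, p) = k_of h (s, p)" if s: "s \<in> ball 0 1 - ball 0 (9/10)" and p: "p \<in> O1" for s p
  proof -
    have s1: "norm s \<le> 1" and s2: "norm s \<ge> 9/10" using s by auto
    have "(9/10)\<^sup>2 \<le> (norm s)\<^sup>2" using s2 by (rule power_mono) simp
    then have s3: "(norm s)\<^sup>2 \<ge> 3/4" by (simp add: power2_eq_square)
    obtain a v P where a: "a \<noteq> 0" "P = {v. functional y a v = 0}" and p: "p = (P, coset P v)"
      using O1_cases[OF dim y N[OF s1] p] .
    have "k (s, p) = (cmod (functional y a v))\<^sup>2 / N s a"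
      unfolding k_def p prod.case by (rule metric_of_dual_eq[OF y N[OF s1] a])
    also have "N s a = (\<Sum>n\<in>UNIV. l s n * (cmod (a $ n))\<^sup>2)"
      unfolding N_def l_def by (rule family_outside[OF s3])
    also have "(cmod (functional y a v))\<^sup>2 / \<dots> = k_of h (s, p)"
      unfolding p by (rule k_of_diagonal[OF y l a, symmetric]) (simp add: h_def)
    finally show ?thesis .
  qed
  ultimately show ?thesis
    using curved not_curved
    by (intro exI[of _ k] exI[of _ "3/5"] exI[of _ "9/10"] conjI allI impI exI[of _ h] ballI) auto
qed

end
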